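(* Let $(\hat G,\hat T)$ be a bipartite graft. If $(\hat G,\hat T)$ is a synthesis of a skeleton comb $(G,T;A,B)$ and a set of tooth grafts $\{(G_v,T_v;r_v):v\in B\}$, then $A$ is a maximal bipartitic extreme set of $(\hat G,\hat T)$ with empty fringe, i.e. $C_A=\emptyset$. Conversely, if $A$ is a maximal bipartitic extreme set of $(\hat G,\hat T)$, then the graft obtained from $(\hat G,\hat T)$ by fringe removal (deleting all vertices of $C_A$ and removing them from $\hat T$) is a synthesis of a skeleton comb whose spine set is $A$ and a set of tooth grafts.
   Context: All graphs are finite (parallel edges allowed). A graft is a pair $(G,T)$ with $T\subseteq V(G)$; a join is $F\subseteq E(G)$ such that each vertex is incident to an odd number of edges of $F$ iff it lies in $T$; a minimum join is one of minimum size. A bipartite graft has $G$ bipartite with given color classes. For $F\subseteq E$ and a subgraph $Q$, $w_F(Q)=|E(Q)\setminus F|-|E(Q)\cap F|$; $\lambda_{(G,T),F}(x,y)$ is the minimum of $w_F(P)$ over paths $P$ between $x$ and $y$ ($0$ if $x=y$); for a minimum join it does not depend on the choice of $F$. $\delta_G(Y)$: edges with exactly one end in $Y$; $E_G[Y,Z]$: edges joining $Y$ and $Z$. A comb $(G,T;A,B)$ is a bipartite graft with color classes $A$ (spine set) and $B$ (tooth set) such that every minimum join $F$ satisfies $|\delta_G(v)\cap F|=1$ for all $v\in B$. A graft $(H,S)$ is primal with respect to $r$ if $\lambda_{(H,S),F'}(r,x)\le0$ for all $x$; then $A_{(H,S)}(r):=\{x:\lambda_{(H,S),F'}(r,x)=0\}$.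 Graft contraction: identify a vertex set $Y$ into one vertex (deleting edges inside $Y$), the new vertex being terminal iff $|Y\cap S|$ is odd. Synthesis: given a comb $(G,T;A,B)$ and, for each $v\in B$, a bipartite graft $(G_v,T_v)$ with color classes $A_v,B_v$, primal with respect to $r_v\in A_v$ (all pairwise disjoint and disjoint from $G$), a bipartite graft $(\hat G,\hat T)$ is a synthesis if (1) each $G_v$ is a subgraph of $\hat G$ with the edges of $\hat G$ inside $V(G_v)$ exactly $E(G_v)$ and $\hat T\cap V(G_v)=T_v\Delta\{r_v\}$; (2) contracting each $V(G_v)$ into $v$ yields exactly $(G,T)$; (3) $\delta_{\hat G}(V(G_v))=E_{\hat G}[A,A_{(G_v,T_v)}(r_v)]$. A set $X$ is extreme if $\lambda(x,y)\ge0$ for all $x,y\in X$; bipartitic if contained in a color class; maximal bipartitic extreme if not properly contained in another bipartitic extreme set. $D_X:=\{y\notin X:\min_{x\in X}\lambda(x,y)<0\}$, $C_X:=V\setminus X\setminus D_X$ (the fringe of $X$).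
   Formalization: A synthesis must also have, up to order, the color classes A ∪ ⋃B_v and ⋃A_v (otherwise false for disconnected grafts); combs, primal grafts and grafts with extreme sets are required to have a join; vertices come from an infinite universe in the converse. *)

theory Defs
  imports "HOL-Library.Extended_Real" "HOL-Library.Disjoint_Sets"
begin

text \<open>
  Undirected multigraphs: every edge is a name carrying its set of two ends, so distinct names
  with equal ends are parallel edges. Only the values of \<open>ends\<close> on \<open>edges\<close> are relevant.
  Grafts extend graphs by a set of terminals, bipartite grafts extend grafts by two colour classes.
\<close>

record ('v, 'e) mgraph =
  verts :: "'v set"
  edges :: "'e set"
  ends :: "'e \<Rightarrow> 'v set"

record ('v, 'e) graft = "('v, 'e) mgraph" +
  terms :: "'v set"

record ('v, 'e) bgraft = "('v, 'e) graft" +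
  colA :: "'v set"
  colB :: "'v set"

definition fin_mgraph :: "('v, 'e, 'z) mgraph_scheme \<Rightarrow> bool" where
  "fin_mgraph G \<longleftrightarrow> finite (verts G) \<and> finite (edges G) \<and>
     (\<forall>e\<in>edges G. ends G e \<subseteq> verts G \<and> card (ends G e) = 2)"

definition is_graft :: "('v, 'e, 'z) graft_scheme \<Rightarrow> bool" where
  "is_graft G \<longleftrightarrow> fin_mgraph G \<and> terms G \<subseteq> verts G"

definition bipartite_graft :: "('v, 'e, 'z) bgraft_scheme \<Rightarrow> bool" where
  "bipartite_graft G \<longleftrightarrow> is_graft G \<and>
     colA G \<union> colB G = verts G \<and> colA G \<inter> colB G = {} \<and>
     (\<forall>e\<in>edges G. \<exists>a\<in>colA G. \<exists>b\<in>colB G. ends G e = {a, b})"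

definition cut :: "('v, 'e, 'z) mgraph_scheme \<Rightarrow> 'v set \<Rightarrow> 'e set" where
  "cut G Y = {e \<in> edges G. card (ends G e \<inter> Y) = 1}"

definition edges_inside :: "('v, 'e, 'z) mgraph_scheme \<Rightarrow> 'v set \<Rightarrow> 'e set" where
  "edges_inside G Y = {e \<in> edges G. ends G e \<subseteq> Y}"

definition edges_between :: "('v, 'e, 'z) mgraph_scheme \<Rightarrow> 'v set \<Rightarrow> 'v set \<Rightarrow> 'e set" where
  "edges_between G Y Z = {e \<in> edges G. \<exists>y\<in>Y. \<exists>z\<in>Z. ends G e = {y, z}}"

definition subgraph :: "('v, 'e, 'y) mgraph_scheme \<Rightarrow> ('v, 'e, 'z) mgraph_scheme \<Rightarrow> bool" where
  "subgraph H G \<longleftrightarrow> verts H \<subseteq> verts G \<and> edges H \<subseteq> edges G \<and> (\<forall>e\<in>edges H. ends H e = ends G e)"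

definition is_join :: "('v, 'e, 'z) graft_scheme \<Rightarrow> 'e set \<Rightarrow> bool" where
  "is_join G F \<longleftrightarrow> F \<subseteq> edges G \<and>
     (\<forall>v\<in>verts G. odd (card {e \<in> F. v \<in> ends G e}) \<longleftrightarrow> v \<in> terms G)"

definition minimum_join :: "('v, 'e, 'z) graft_scheme \<Rightarrow> 'e set \<Rightarrow> bool" where
  "minimum_join G F \<longleftrightarrow> is_join G F \<and> (\<forall>F'. is_join G F' \<longrightarrow> card F \<le> card F')"

definition has_join :: "('v, 'e, 'z) graft_scheme \<Rightarrow> bool" where
  "has_join G \<longleftrightarrow> (\<exists>F. is_join G F)"

text \<open>A path is given by its vertices \<open>vs\<close>, without repetition, and its edges \<open>es\<close>, in order.\<close>

definition is_path :: "('v, 'e, 'z) mgraph_scheme \<Rightarrow> 'v \<Rightarrow> 'v list \<Rightarrow> 'e list \<Rightarrow> 'v \<Rightarrow> bool" where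
  "is_path G x vs es y \<longleftrightarrow>
     vs \<noteq> [] \<and> hd vs = x \<and> last vs = y \<and> distinct vs \<and> set vs \<subseteq> verts G \<and>
     length vs = Suc (length es) \<and>
     (\<forall>i<length es. es ! i \<in> edges G \<and> ends G (es ! i) = {vs ! i, vs ! Suc i})"

definition weight :: "'e set \<Rightarrow> 'e set \<Rightarrow> int" where
  "weight F Q = int (card (Q - F)) - int (card (Q \<inter> F))"

text \<open>
  The value is \<open>\<infinity>\<close> if there is no path between \<open>x\<close> and \<open>y\<close>. For a vertex \<open>x = y\<close> only the trivial
  path exists, and the value is 0.
\<close>

definition lambda_wrt :: "('v, 'e, 'z) mgraph_scheme \<Rightarrow> 'e set \<Rightarrow> 'v \<Rightarrow> 'v \<Rightarrow> ereal" where
  "lambda_wrt G F x y =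
     (INF (vs, es)\<in>{(vs, es). is_path G x vs es y}. ereal (real_of_int (weight F (set es))))"

text \<open>
  For minimum joins \<open>F\<close> the distance does not depend on \<open>F\<close>, so any of them may be selected. This is
  meaningful only for grafts that have a join (equivalently, every component contains an even number
  of terminals). Notions based on minimum joins therefore include this condition below.
\<close>

definition lambda :: "('v, 'e, 'z) graft_scheme \<Rightarrow> 'v \<Rightarrow> 'v \<Rightarrow> ereal" where
  "lambda G x y = lambda_wrt G (SOME F. minimum_join G F) x y"

text \<open>In a comb, \<open>colA\<close> is the spine set and \<open>colB\<close> the tooth set.\<close>

definition comb :: "('v, 'e, 'z) bgraft_scheme \<Rightarrow> bool" where
  "comb G \<longleftrightarrow> bipartite_graft G \<and> has_join G \<and>
     (\<forall>F. minimum_join G F \<longrightarrow> (\<forall>v\<in>colB G. card (cut G {v} \<inter> F) = 1))"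

definition primal :: "('v, 'e, 'z) graft_scheme \<Rightarrow> 'v \<Rightarrow> bool" where
  "primal H r \<longleftrightarrow> is_graft H \<and> has_join H \<and> r \<in> verts H \<and> (\<forall>x\<in>verts H. lambda H r x \<le> 0)"

definition zero_set :: "('v, 'e, 'z) graft_scheme \<Rightarrow> 'v \<Rightarrow> 'v set" where
  "zero_set H r = {x \<in> verts H. lambda H r x = 0}"

text \<open>
  Simultaneous contraction of pairwise disjoint vertex sets \<open>Y v\<close> into new vertices \<open>v\<close>, for \<open>v \<in> I\<close>.
\<close>

definition contract_vertex :: "'v set \<Rightarrow> ('v \<Rightarrow> 'v set) \<Rightarrow> 'v \<Rightarrow> 'v" where
  "contract_vertex I Y x = (if \<exists>v\<in>I. x \<in> Y v then THE v. v \<in> I \<and> x \<in> Y v else x)"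

definition contract :: "('v, 'e, 'z) graft_scheme \<Rightarrow> 'v set \<Rightarrow> ('v \<Rightarrow> 'v set) \<Rightarrow> ('v, 'e) graft" where
  "contract G I Y =
     \<lparr>verts = (verts G - (\<Union>v\<in>I. Y v)) \<union> I,
      edges = edges G - (\<Union>v\<in>I. edges_inside G (Y v)),
      ends = (\<lambda>e. contract_vertex I Y ` ends G e),
      terms = (terms G - (\<Union>v\<in>I. Y v)) \<union> {v \<in> I. odd (card (Y v \<inter> terms G))}\<rparr>"

text \<open>Equality of grafts, disregarding the values of \<open>ends\<close> outside of the edge set.\<close>

definition same_graft :: "('v, 'e, 'y) graft_scheme \<Rightarrow> ('v, 'e, 'z) graft_scheme \<Rightarrow> bool" where
  "same_graft G H \<longleftrightarrow> verts G = verts H \<and> edges G = edges H \<and>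
     (\<forall>e\<in>edges G. ends G e = ends H e) \<and> terms G = terms H"

definition tooth_grafts ::
  "('v, 'e) bgraft \<Rightarrow> ('v \<Rightarrow> ('v, 'e) bgraft) \<Rightarrow> ('v \<Rightarrow> 'v) \<Rightarrow> bool" where
  "tooth_grafts G H r \<longleftrightarrow>
     (\<forall>v\<in>colB G. bipartite_graft (H v) \<and> r v \<in> colA (H v) \<and> primal (H v) (r v) \<and>
        verts (H v) \<inter> verts G = {}) \<and>
     disjoint_family_on (\<lambda>v. verts (H v)) (colB G)"

text \<open>
  \<open>synthesis K G H r\<close>: the bipartite graft \<open>K\<close> is a synthesis of the comb \<open>G\<close> and the grafts \<open>H v\<close>
  with roots \<open>r v\<close>, for \<open>v \<in> colB G\<close>. The vertices in \<open>colB G\<close> are the new vertices of the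
  contraction, hence not vertices of \<open>K\<close>. Up to order, the colour classes of \<open>K\<close> are those inherited
  from \<open>G\<close> and the \<open>H v\<close>: the edges between \<open>colA G\<close> and \<open>H v\<close> end in \<open>colA (H v)\<close>. This has to be
  said, because the colour classes of a disconnected graph are not determined by the graph.
\<close>

definition synthesis ::
  "('v, 'e) bgraft \<Rightarrow> ('v, 'e) bgraft \<Rightarrow> ('v \<Rightarrow> ('v, 'e) bgraft) \<Rightarrow> ('v \<Rightarrow> 'v) \<Rightarrow> bool" where
  "synthesis K G H r \<longleftrightarrow>
     bipartite_graft K \<and>
     {colA K, colB K} =
       {colA G \<union> (\<Union>v\<in>colB G. colB (H v)), \<Union>v\<in>colB G. colA (H v)} \<and>
     (\<forall>v\<in>colB G. subgraph (H v) K \<and> edges_inside K (verts (H v)) = edges (H v) \<and>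
        terms K \<inter> verts (H v) = sym_diff (terms (H v)) {r v}) \<and>
     colB G \<inter> verts K = {} \<and>
     same_graft (contract K (colB G) (\<lambda>v. verts (H v))) G \<and>
     (\<forall>v\<in>colB G. cut K (verts (H v)) = edges_between K (colA G) (zero_set (H v) (r v)))"

definition extreme :: "('v, 'e, 'z) graft_scheme \<Rightarrow> 'v set \<Rightarrow> bool" where
  "extreme G X \<longleftrightarrow> has_join G \<and> X \<subseteq> verts G \<and> (\<forall>x\<in>X. \<forall>y\<in>X. lambda G x y \<ge> 0)"

definition bipartitic :: "('v, 'e, 'z) bgraft_scheme \<Rightarrow> 'v set \<Rightarrow> bool" where
  "bipartitic G X \<longleftrightarrow> X \<subseteq> colA G \<or> X \<subseteq> colB G"

definition maximal_bipartitic_extreme :: "('v, 'e, 'z) bgraft_scheme \<Rightarrow> 'v set \<Rightarrow> bool" where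
  "maximal_bipartitic_extreme G X \<longleftrightarrow> bipartitic G X \<and> extreme G X \<and>
     (\<nexists>Y. X \<subset> Y \<and> bipartitic G Y \<and> extreme G Y)"

definition neg_set :: "('v, 'e, 'z) graft_scheme \<Rightarrow> 'v set \<Rightarrow> 'v set" where
  "neg_set G X = {y \<in> verts G - X. (INF x\<in>X. lambda G x y) < 0}"

definition fringe :: "('v, 'e, 'z) graft_scheme \<Rightarrow> 'v set \<Rightarrow> 'v set" where
  "fringe G X = verts G - X - neg_set G X"

definition fringe_removal :: "('v, 'e) bgraft \<Rightarrow> 'v set \<Rightarrow> ('v, 'e) bgraft" where
  "fringe_removal G X =
     \<lparr>verts = verts G - fringe G X,
      edges = {e \<in> edges G. ends G e \<inter> fringe G X = {}},
      ends = ends G,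
      terms = terms G - fringe G X,
      colA = colA G - fringe G X,
      colB = colB G - fringe G X\<rparr>"

end

theory Submission
  imports Defs
begin

text \<open>
  Write \<open>f U\<close> for the least size of an edge set whose set of odd vertices is \<open>U\<close>. Distances are
  differences of such values: \<open>\<lambda>(x, y) = f (T \<oplus> {x} \<oplus> {y}) - f T\<close>. Swapping two edge sets along a path of
  their symmetric difference preserves the sum of their sizes; this exchange property, together with
  the fact that \<open>v \<mapsto> f (S \<oplus> {v})\<close> changes by exactly one along every edge of a bipartite graph, yields
  Sebo's theorem on level sets without any contraction of stars: if \<open>D\<close> is a component of
  \<open>{v. f (S \<oplus> {v}) \<le> j}\<close>, then a minimum join of \<open>S \<oplus> {v}\<close> uses exactly one edge of the cut of \<open>D\<close> if
  \<open>v \<notin> D\<close> and none otherwise.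

  For a tooth with root \<open>r\<close> and \<open>S = T \<oplus> {r}\<close> the whole graph is such a component, and its vertices of top
  level form the zero set. Hence every join of a synthesis spends at least one cut edge and the size of
  a minimum join of the tooth on each tooth, and both bounds are attained simultaneously.
  Conversely, identify the vertices of a maximal bipartitic extreme set \<open>X\<close> with one of them. The vertices at
  negative distance from \<open>X\<close> form a level set, whose components are the teeth, rooted at the inner ends
  of the join edges that leave them. By maximality, no edge joins a tooth to the fringe.
\<close>

section \<open>Joins and the exchange property\<close>

definition sdiff :: "'a set \<Rightarrow> 'a set \<Rightarrow> 'a set" (infixl "\<oplus>" 65) where
  "A \<oplus> B = sym_diff A B"

lemma sdiff_iff [simp]: "x \<in> A \<oplus> B \<longleftrightarrow> (x \<in> A) \<noteq> (x \<in> B)"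
  by (auto simp: sdiff_def)

lemma sdiff_assoc: "(A \<oplus> B) \<oplus> C = A \<oplus> (B \<oplus> C)"
  and sdiff_commute: "A \<oplus> B = B \<oplus> A"
  and sdiff_left_commute: "A \<oplus> (B \<oplus> C) = B \<oplus> (A \<oplus> C)"
  and sdiff_self: "A \<oplus> A = {}"
  and sdiff_left_self: "A \<oplus> (A \<oplus> B) = B"
  and sdiff_empty: "A \<oplus> {} = A" "{} \<oplus> A = A"
  by (auto simp: set_eq_iff)

lemmas sdiff_ac = sdiff_assoc sdiff_commute sdiff_left_commute sdiff_self sdiff_left_self sdiff_empty

lemma finite_sdiff [simp]: "finite A \<Longrightarrow> finite B \<Longrightarrow> finite (A \<oplus> B)"
  by (simp add: sdiff_def)

lemma card_sdiff_le: "card (A \<oplus> B) \<le> card A + card B"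
  if "finite A" "finite B"
proof -
  have "card (A \<oplus> B) \<le> card (A \<union> B)"
    using that by (intro card_mono) auto
  then show ?thesis using card_Un_le[of A B] by simp
qed

lemma card_sdiff: "int (card (A \<oplus> B)) = int (card A) + int (card B) - 2 * int (card (A \<inter> B))"
  if "finite A" "finite B"
proof -
  have "card (A \<oplus> B) = card (A - B) + card (B - A)"
    unfolding sdiff_def using that by (intro card_Un_disjoint) auto
  moreover have "card A = card (A - B) + card (A \<inter> B)"
    using card_Int_Diff[OF that(1), of B] by simp
  moreover have "card B = card (B - A) + card (A \<inter> B)"
    using card_Int_Diff[OF that(2), of A] by (simp add: Int_commute)
  ultimately show ?thesis by simp
qed

lemma odd_card_sdiff: "odd (card (A \<oplus> B)) \<longleftrightarrow> odd (card A) \<noteq> odd (card B)"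
  if "finite A" "finite B"
  using card_sdiff[OF that] by presburger

lemma card_exchange: "card (J \<oplus> P) + card (J' \<oplus> P) = card J + card J'"
  if "finite J" "finite J'" "P \<subseteq> J \<oplus> J'"
proof -
  have P: "finite P" using that finite_subset finite_sdiff by blast
  have "P = (J \<inter> P) \<union> (J' \<inter> P)" "(J \<inter> P) \<inter> (J' \<inter> P) = {}" using that(3) by auto
  then have "card P = card (J \<inter> P) + card (J' \<inter> P)"
    using that P card_Un_disjoint[of "J \<inter> P" "J' \<inter> P"] by simp
  then show ?thesis using card_sdiff[OF that(1) P] card_sdiff[OF that(2) P] by linarith
qed

definition boundary :: "('e \<Rightarrow> 'v set) \<Rightarrow> 'e set \<Rightarrow> 'v set" where
  "boundary en J = {v. odd (card {e \<in> J. v \<in> en e})}"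

lemma boundary_cong: "(\<And>e. e \<in> J \<Longrightarrow> en e = en' e) \<Longrightarrow> boundary en J = boundary en' J"
  unfolding boundary_def by (metis (mono_tags, lifting) Collect_cong)

lemma boundary_empty [simp]: "boundary en {} = {}"
  by (simp add: boundary_def)

lemma boundary_singleton [simp]: "boundary en {e} = en e"
proof -
  have "{e' \<in> {e}. v \<in> en e'} = (if v \<in> en e then {e} else {})" for v by auto
  then show ?thesis by (simp add: boundary_def)
qed

lemma boundary_sdiff: "boundary en (J \<oplus> J') = boundary en J \<oplus> boundary en J'" if "finite J" "finite J'"
proof -
  have "{e \<in> J \<oplus> J'. v \<in> en e} = {e \<in> J. v \<in> en e} \<oplus> {e \<in> J'. v \<in> en e}" for v by auto
  then show ?thesis using that by (auto simp: boundary_def odd_card_sdiff)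
qed

lemma boundary_subset: "boundary en J \<subseteq> (\<Union>e\<in>J. en e)"
proof
  fix v assume "v \<in> boundary en J"
  then have "{e \<in> J. v \<in> en e} \<noteq> {}" by (auto simp: boundary_def simp del: Collect_empty_eq)
  then show "v \<in> (\<Union>e\<in>J. en e)" by auto
qed

locale multigraph =
  fixes E :: "'e set" and en :: "'e \<Rightarrow> 'v set"
  assumes finE: "finite E" and card2: "e \<in> E \<Longrightarrow> card (en e) = 2"
begin

definition crossing :: "'e set \<Rightarrow> 'v set \<Rightarrow> 'e set" where
  "crossing J D = {e \<in> J. card (en e \<inter> D) = 1}"

definition joins :: "'v set \<Rightarrow> 'e set \<Rightarrow> bool" where
  "joins U J \<longleftrightarrow> J \<subseteq> E \<and> boundary en J = U"

text \<open>The value is 0 if there is no such edge set.\<close>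

definition tau :: "'v set \<Rightarrow> nat" where
  "tau U = Inf (card ` {J. joins U J})"

definition feasible :: "'v set \<Rightarrow> bool" where
  "feasible U \<longleftrightarrow> (\<exists>J. joins U J)"

lemma joins_finite: "joins U J \<Longrightarrow> finite J"
  using finE finite_subset joins_def by metis

lemma tau_le: "joins U J \<Longrightarrow> tau U \<le> card J"
  unfolding tau_def by (intro cInf_lower) auto

lemma tau_attained:
  assumes "feasible U" obtains J where "joins U J" "card J = tau U"
proof -
  have "Inf (card ` {J. joins U J}) \<in> card ` {J. joins U J}"
    using assms by (intro Inf_nat_def1) (auto simp: feasible_def)
  then show ?thesis using that unfolding tau_def by auto
qed

lemma joins_sdiff: "joins U J \<Longrightarrow> joins U' J' \<Longrightarrow> joins (U \<oplus> U') (J \<oplus> J')"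
  using boundary_sdiff joins_finite unfolding joins_def by (metis Un_Diff Diff_subset sdiff_def subset_trans sup.bounded_iff)

lemma joins_subset: "P \<subseteq> E \<Longrightarrow> joins (boundary en P) P"
  by (simp add: joins_def)

lemma en_cases:
  assumes "e \<in> E" obtains a b where "en e = {a, b}" "a \<noteq> b"
  using card2[OF assms] by (meson card_2_iff)

lemma en_sdiff: "e \<in> E \<Longrightarrow> en e = {a, b} \<Longrightarrow> en e = {a} \<oplus> {b}"
  using card2[of e] by (auto simp: sdiff_def card_insert_if split: if_splits)

lemma joins_edge:
  assumes "joins U J" "e \<in> E" "en e = {a, b}"
  shows "joins (U \<oplus> ({a} \<oplus> {b})) (J \<oplus> {e})" "card (J \<oplus> {e}) \<le> card J + 1"
proof -
  have "joins ({a} \<oplus> {b}) {e}" using en_sdiff[OF assms(2,3)] assms(2) by (simp add: joins_def)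
  then show "joins (U \<oplus> ({a} \<oplus> {b})) (J \<oplus> {e})" by (rule joins_sdiff[OF assms(1)])
  show "card (J \<oplus> {e}) \<le> card J + 1" using card_sdiff_le[of J "{e}"] joins_finite[OF assms(1)] by simp
qed

lemma finite_boundary: "J \<subseteq> E \<Longrightarrow> finite (boundary en J)"
proof -
  assume J: "J \<subseteq> E"
  have "finite (en e)" if "e \<in> J" for e using that J card2[of e] card_ge_0_finite[of "en e"] by auto
  then have "finite (\<Union>e\<in>J. en e)"
    using J finE finite_subset by blast
  then show ?thesis using boundary_subset finite_subset by metis
qed

lemma parity_crossing:
  assumes "J \<subseteq> E"
  shows "odd (card (boundary en J \<inter> D)) \<longleftrightarrow> odd (card (crossing J D))"
proof -
  have "finite J" using assms finE finite_subset by blast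
  then show ?thesis using assms
  proof (induction J rule: finite_induct)
    case empty then show ?case by (simp add: crossing_def)
  next
    case (insert e J)
    have e: "e \<in> E" and J: "J \<subseteq> E" using insert.prems by auto
    obtain a b where ab: "en e = {a, b}" "a \<noteq> b" using en_cases[OF e] .
    have ins: "insert e J = J \<oplus> {e}" using insert.hyps by (auto simp: set_eq_iff)
    have boundary: "boundary en (insert e J) \<inter> D = (boundary en J \<inter> D) \<oplus> (en e \<inter> D)"
      unfolding ins using insert.hyps by (subst boundary_sdiff) (auto simp: set_eq_iff)
    have "odd (card (boundary en (insert e J) \<inter> D)) \<longleftrightarrow> odd (card (boundary en J \<inter> D)) \<noteq> odd (card (en e \<inter> D))"
      unfolding boundary using finite_boundary[OF J] ab by (subst odd_card_sdiff) auto
    moreover have "odd (card (en e \<inter> D)) \<longleftrightarrow> card (en e \<inter> D) = 1"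
      using ab by (cases "a \<in> D"; cases "b \<in> D") auto
    moreover have "crossing (insert e J) D =
        (if card (en e \<inter> D) = 1 then insert e (crossing J D) else crossing J D)"
      by (auto simp: crossing_def)
    moreover have "e \<notin> crossing J D" "finite (crossing J D)"
      using insert.hyps by (auto simp: crossing_def)
    ultimately show ?case using insert.IH[OF J] by auto
  qed
qed

lemma even_boundary: "J \<subseteq> E \<Longrightarrow> even (card (boundary en J))"
proof -
  assume J: "J \<subseteq> E"
  then have "crossing J UNIV = {}" using card2 by (auto simp: crossing_def subset_iff)
  then show ?thesis using parity_crossing[OF J, of UNIV] by simp
qed

lemma closed_boundary_even:
  assumes "J \<subseteq> E" "\<And>e a b. e \<in> J \<Longrightarrow> en e = {a, b} \<Longrightarrow> a \<in> R \<Longrightarrow> b \<in> R"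
  shows "even (card (boundary en J \<inter> R))"
proof -
  have "crossing J R = {}"
  proof -
    { fix e assume e: "e \<in> J" "card (en e \<inter> R) = 1"
      obtain a b where ab: "en e = {a, b}" "a \<noteq> b" using en_cases assms(1) e(1) by blast
      have "a \<in> R \<longleftrightarrow> b \<in> R" using assms(2)[OF e(1)] ab by (metis insert_commute)
      then have False using e(2) ab by (cases "a \<in> R") auto }
    then show ?thesis by (auto simp: crossing_def)
  qed
  then show ?thesis using parity_crossing[OF assms(1), of R] by simp
qed

definition inside :: "'e set \<Rightarrow> 'v set \<Rightarrow> 'e set" where
  "inside J D = {e \<in> J. en e \<subseteq> D}"

lemma split_by:
  assumes "J \<subseteq> E"
  shows "J = inside J D \<oplus> crossing J D \<oplus> inside J (- D)"
proof -
  { fix e assume "e \<in> J"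
    then obtain a b where "en e = {a, b}" "a \<noteq> b" using en_cases assms by blast
    then have "e \<in> inside J D \<oplus> crossing J D \<oplus> inside J (- D)"
      using \<open>e \<in> J\<close> by (cases "a \<in> D"; cases "b \<in> D") (auto simp: inside_def crossing_def) }
  moreover have "inside J D \<oplus> crossing J D \<oplus> inside J (- D) \<subseteq> J"
    by (auto simp: inside_def crossing_def)
  ultimately show ?thesis by blast
qed

lemma boundary_inside:
  assumes "J \<subseteq> E"
  shows "boundary en (inside J D) = (boundary en J \<inter> D) \<oplus> (boundary en (crossing J D) \<inter> D)"
proof -
  have "finite J" using assms finE finite_subset by blast
  then have fin: "finite (inside J D)" "finite (crossing J D)" "finite (inside J (- D))"
    by (simp_all add: inside_def crossing_def)
  have "boundary en J = boundary en (inside J D) \<oplus> boundary en (crossing J D) \<oplus> boundary en (inside J (- D))"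
    using fin by (subst split_by[OF assms, of D]) (simp add: boundary_sdiff)
  moreover have "boundary en (inside J D) \<subseteq> D" "boundary en (inside J (- D)) \<subseteq> - D"
    using boundary_subset by (fastforce simp: inside_def)+
  ultimately show ?thesis by (auto simp: subset_iff)
qed

lemma inside_Un_crossing: "J \<subseteq> E \<Longrightarrow> inside J D \<union> crossing J D = {e \<in> J. en e \<inter> D \<noteq> {}}"
  and inside_Int_crossing: "J \<subseteq> E \<Longrightarrow> inside J D \<inter> crossing J D = {}"
proof -
  assume J: "J \<subseteq> E"
  have "e \<in> inside J D \<and> e \<notin> crossing J D \<or> e \<notin> inside J D \<and> (e \<in> crossing J D \<longleftrightarrow> en e \<inter> D \<noteq> {})"
    if e: "e \<in> J" for e
  proof -
    obtain a b where "en e = {a, b}" "a \<noteq> b" using en_cases J e by blast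
    then show ?thesis using e by (cases "a \<in> D"; cases "b \<in> D") (auto simp: inside_def crossing_def)
  qed
  moreover have "en e \<noteq> {}" if "e \<in> J" for e using J that card2 by force
  ultimately show "inside J D \<union> crossing J D = {e \<in> J. en e \<inter> D \<noteq> {}}" "inside J D \<inter> crossing J D = {}"
    by (fastforce simp: inside_def crossing_def)+
qed

lemma link:
  assumes "M \<subseteq> E" "z \<in> boundary en M"
  obtains w P where "w \<in> boundary en M" "w \<noteq> z" "P \<subseteq> M" "boundary en P = {z} \<oplus> {w}"
proof -
  define R where "R = {w. \<exists>P\<subseteq>M. boundary en P = {z} \<oplus> {w}}"
  have z: "z \<in> R" unfolding R_def by (auto intro!: exI[of _ "{}"] simp: sdiff_self)
  have "even (card (boundary en M \<inter> R))"
  proof (rule closed_boundary_even[OF assms(1)])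
    fix e a b assume e: "e \<in> M" "en e = {a, b}" "a \<in> R"
    then obtain P where P: "P \<subseteq> M" "boundary en P = {z} \<oplus> {a}" by (auto simp: R_def)
    have "joins (({z} \<oplus> {a}) \<oplus> ({a} \<oplus> {b})) (P \<oplus> {e})"
      using joins_edge(1)[of _ P e a b] P e assms(1) by (auto simp: joins_def)
    moreover have "P \<oplus> {e} \<subseteq> M" using P e by auto
    ultimately show "b \<in> R" unfolding R_def joins_def by (auto simp: sdiff_ac)
  qed
  moreover have "finite (boundary en M \<inter> R)" using finite_boundary[OF assms(1)] by simp
  ultimately have "boundary en M \<inter> R \<noteq> {z}" by auto
  then obtain w where "w \<in> boundary en M" "w \<in> R" "w \<noteq> z" using assms(2) z by blast
  then show ?thesis using that by (auto simp: R_def)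
qed

lemma exchange:
  assumes "joins U J" "joins U' J'" "z \<in> U \<oplus> U'"
  obtains w K K' where "w \<in> U \<oplus> U'" "w \<noteq> z" "joins (U \<oplus> ({z} \<oplus> {w})) K" "joins (U' \<oplus> ({z} \<oplus> {w})) K'"
    "card K + card K' = card J + card J'"
proof -
  have M: "joins (U \<oplus> U') (J \<oplus> J')" using joins_sdiff assms by blast
  then obtain w P where P: "w \<in> U \<oplus> U'" "w \<noteq> z" "P \<subseteq> J \<oplus> J'" "boundary en P = {z} \<oplus> {w}"
    using link[of "J \<oplus> J'" z] assms(3) unfolding joins_def by metis
  have "joins ({z} \<oplus> {w}) P" using P M unfolding joins_def by auto
  then have "joins (U \<oplus> ({z} \<oplus> {w})) (J \<oplus> P)" "joins (U' \<oplus> ({z} \<oplus> {w})) (J' \<oplus> P)"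
    using joins_sdiff assms by blast+
  then show ?thesis using that[OF P(1,2)] card_exchange P(3) joins_finite assms by metis
qed

lemma exchange4:
  assumes "joins U J" "joins U' J'" "U \<oplus> U' = {z} \<oplus> {x} \<oplus> {y} \<oplus> {v}"
  obtains w K K' where "w = x \<or> w = y \<or> w = v" "joins (U \<oplus> ({z} \<oplus> {w})) K" "joins (U' \<oplus> ({z} \<oplus> {w})) K'"
    "card K + card K' = card J + card J'"
proof (cases "z \<in> U \<oplus> U'")
  case True
  from exchange[OF assms(1,2) True] obtain w K K' where *: "w \<in> U \<oplus> U'" "w \<noteq> z"
    "joins (U \<oplus> ({z} \<oplus> {w})) K" "joins (U' \<oplus> ({z} \<oplus> {w})) K'" "card K + card K' = card J + card J'" .
  have "w = x \<or> w = y \<or> w = v" using *(1,2) unfolding assms(3) by auto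
  then show ?thesis using that * by blast
next
  case False
  then have "z = x \<or> z = y \<or> z = v" unfolding assms(3) by auto
  then show ?thesis using that[of z J J'] assms(1,2) by (auto simp: sdiff_self sdiff_empty)
qed

lemma extreme_even_set:
  assumes F: "joins W F" "card F = m" and min: "\<And>J. joins W J \<Longrightarrow> m \<le> card J"
    and pair: "\<And>p q J. p \<in> Z \<Longrightarrow> q \<in> Z \<Longrightarrow> joins (W \<oplus> ({p} \<oplus> {q})) J \<Longrightarrow> m \<le> card J"
  shows "finite U \<Longrightarrow> U \<subseteq> Z \<Longrightarrow> even (card U) \<Longrightarrow> joins (W \<oplus> U) J \<Longrightarrow> m \<le> card J"
proof (induction "card U" arbitrary: U J rule: less_induct)
  case less
  show ?case
  proof (cases "U = {}")
    case True
    then show ?thesis using less.prems min by (simp add: sdiff_empty)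
  next
    case False
    then obtain z where z: "z \<in> U" by auto
    have "(W \<oplus> U) \<oplus> W = U" by (simp add: sdiff_ac)
    then obtain w K K' where w: "w \<in> U" "w \<noteq> z" "joins ((W \<oplus> U) \<oplus> ({z} \<oplus> {w})) K"
      "joins (W \<oplus> ({z} \<oplus> {w})) K'" "card K + card K' = card J + card F"
      using exchange[OF less.prems(4) F(1), of z] z by metis
    have "U \<oplus> ({z} \<oplus> {w}) = U - {z, w}" using z w by auto
    then have K: "joins (W \<oplus> (U - {z, w})) K" using w(3) by (simp add: sdiff_assoc)
    have "card (U - {z, w}) = card U - 2" "2 \<le> card U"
      using z w(1,2) less.prems(1) card_mono[of U "{z, w}"] by (auto simp: card_Diff_subset)
    then have "m \<le> card K"
      using less.hyps[OF _ _ _ _ K] less.prems by fastforce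
    moreover have "m \<le> card K'" using pair[OF _ _ w(4)] z w less.prems by auto
    ultimately show ?thesis using w(5) F(2) by simp
  qed
qed

end

section \<open>Level sets\<close>

locale levels = multigraph E en for E :: "'e set" and en :: "'e \<Rightarrow> 'v set" +
  fixes Cl S :: "'v set"
  assumes bip: "e \<in> E \<Longrightarrow> card (en e \<inter> Cl) = 1"
begin

definition has_level :: "'v \<Rightarrow> bool" where "has_level v \<longleftrightarrow> feasible (S \<oplus> {v})"
definition level :: "'v \<Rightarrow> nat" where "level v = tau (S \<oplus> {v})"

definition eqv :: "'v \<Rightarrow> 'v \<Rightarrow> bool" where
  "eqv d d' \<longleftrightarrow> (\<forall>v J. joins (S \<oplus> {d} \<oplus> {d'} \<oplus> {v}) J \<longrightarrow> level v \<le> card J)"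

lemma level_le: "joins (S \<oplus> {v}) J \<Longrightarrow> level v \<le> card J"
  unfolding level_def by (rule tau_le)

lemma level_attained: assumes "has_level v" obtains J where "joins (S \<oplus> {v}) J" "card J = level v"
  using tau_attained assms unfolding has_level_def level_def by metis

lemma eqvD: "eqv d d' \<Longrightarrow> joins U J \<Longrightarrow> U = S \<oplus> {d} \<oplus> {d'} \<oplus> {v} \<Longrightarrow> level v \<le> card J"
  unfolding eqv_def by blast

lemma eqv_refl: "eqv d d"
  unfolding eqv_def using level_le by (simp add: sdiff_ac)

lemma parity_class: "joins U J \<Longrightarrow> even (card J) \<longleftrightarrow> even (card (U \<inter> Cl))"
proof -
  assume J: "joins U J"
  then have "crossing J Cl = J" using bip by (auto simp: crossing_def joins_def)
  then show ?thesis using parity_crossing[of J Cl] J by (auto simp: joins_def)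
qed

lemma edge_step:
  assumes "has_level a" "e \<in> E" "en e = {a, b}"
  shows "has_level b" "level b \<le> level a + 1"
proof -
  obtain J where J: "joins (S \<oplus> {a}) J" "card J = level a" using level_attained[OF assms(1)] .
  have "joins (S \<oplus> {b}) (J \<oplus> {e})" using joins_edge(1)[OF J(1) assms(2,3)] by (simp add: sdiff_ac)
  then show "has_level b" "level b \<le> level a + 1"
    using joins_edge(2)[OF J(1) assms(2,3)] level_le J(2) by (fastforce simp: has_level_def feasible_def)+
qed

lemma edge_levels:
  assumes "has_level a" "e \<in> E" "en e = {a, b}"
  shows "level b = level a + 1 \<or> level a = level b + 1"
proof -
  have ba: "en e = {b, a}" using assms(3) by auto
  have fb: "has_level b" using edge_step assms by blast
  have le: "level b \<le> level a + 1" "level a \<le> level b + 1" using edge_step assms edge_step[OF fb assms(2) ba] by auto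
  obtain J where J: "joins (S \<oplus> {a}) J" "card J = level a" using level_attained[OF assms(1)] .
  obtain J' where J': "joins (S \<oplus> {b}) J'" "card J' = level b" using level_attained[OF fb] .
  have "joins ({a} \<oplus> {b}) (J \<oplus> J')" using joins_sdiff[OF J(1) J'(1)] by (simp add: sdiff_ac)
  from parity_class[OF this] have "odd (card (J \<oplus> J'))"
    using bip[OF assms(2)] en_sdiff[OF assms(2,3)] by simp
  then have "level a \<noteq> level b" using J J' odd_card_sdiff[of J J'] joins_finite by metis
  then show ?thesis using le by linarith
qed

lemma eqv_trans:
  assumes "eqv d d'" "eqv d' d''" "has_level d'" "level d = level d'" "level d'' = level d'"
  shows "eqv d d''"
  unfolding eqv_def
proof (intro allI impI)
  fix v J assume J: "joins (S \<oplus> {d} \<oplus> {d''} \<oplus> {v}) J"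
  obtain F where F: "joins (S \<oplus> {d'}) F" "card F = level d'" using level_attained[OF assms(3)] .
  have "(S \<oplus> {d} \<oplus> {d''} \<oplus> {v}) \<oplus> (S \<oplus> {d'}) = {d'} \<oplus> {d} \<oplus> {d''} \<oplus> {v}" by (simp add: sdiff_ac)
  from exchange4[OF J F(1) this] obtain w K K' where w: "w = d \<or> w = d'' \<or> w = v"
    and K: "joins (S \<oplus> {d} \<oplus> {d''} \<oplus> {v} \<oplus> ({d'} \<oplus> {w})) K" and K': "joins (S \<oplus> {d'} \<oplus> ({d'} \<oplus> {w})) K'"
    and sum: "card K + card K' = card J + card F" .
  have "level w \<le> card K'" using K' by (intro level_le) (simp add: sdiff_ac)
  moreover
  { assume "w = d" then have "level v \<le> card K" using K by (intro eqvD[OF assms(2)]) (auto simp: sdiff_ac) }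
  moreover
  { assume "w = d''" then have "level v \<le> card K" using K by (intro eqvD[OF assms(1)]) (auto simp: sdiff_ac) }
  moreover
  { assume "w = v" then have "level d \<le> card K" using K by (intro eqvD[OF assms(2)]) (auto simp: sdiff_ac) }
  ultimately show "level v \<le> card J" using w sum F(2) assms(4,5) by auto
qed

lemma eqv_up:
  assumes "eqv z z'" "has_level z" "level z' = level z"
    and e: "e \<in> E" "en e = {z, d}" "level d = level z + 1" and e': "e' \<in> E" "en e' = {z', d'}" "level d' = level z + 1"
  shows "eqv d d'"
  unfolding eqv_def
proof (intro allI impI)
  fix v J assume J: "joins (S \<oplus> {d} \<oplus> {d'} \<oplus> {v}) J"
  obtain F where F: "joins (S \<oplus> {z}) F" "card F = level z" using level_attained[OF assms(2)] .
  have "(S \<oplus> {d} \<oplus> {d'} \<oplus> {v}) \<oplus> (S \<oplus> {z}) = {z} \<oplus> {d} \<oplus> {d'} \<oplus> {v}" by (simp add: sdiff_ac)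
  from exchange4[OF J F(1) this] obtain w K K' where w: "w = d \<or> w = d' \<or> w = v"
    and K: "joins (S \<oplus> {d} \<oplus> {d'} \<oplus> {v} \<oplus> ({z} \<oplus> {w})) K" and K': "joins (S \<oplus> {z} \<oplus> ({z} \<oplus> {w})) K'"
    and sum: "card K + card K' = card J + card F" .
  have "level w \<le> card K'" using K' by (intro level_le) (simp add: sdiff_ac)
  moreover
  { assume "w = d"
    then have "level v \<le> card (K \<oplus> {e'})" using joins_edge(1)[OF K e'(1,2)]
      by (intro eqvD[OF assms(1)]) (auto simp: sdiff_ac)
    then have "level v \<le> card K + 1" using joins_edge(2)[OF K e'(1,2)] by simp }
  moreover
  { assume "w = d'"
    then have "level v \<le> card (K \<oplus> {e})" using joins_edge(1)[OF K e(1,2)] by (intro level_le) (auto simp: sdiff_ac)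
    then have "level v \<le> card K + 1" using joins_edge(2)[OF K e(1,2)] by simp }
  moreover
  { assume "w = v"
    then have "level d' \<le> card (K \<oplus> {e})" using joins_edge(1)[OF K e(1,2)] by (intro level_le) (auto simp: sdiff_ac)
    then have "level z \<le> card K" using joins_edge(2)[OF K e(1,2)] e' by simp }
  ultimately show "level v \<le> card J" using w sum F(2) e e' by auto
qed

inductive conn :: "nat \<Rightarrow> 'v \<Rightarrow> 'v \<Rightarrow> bool" for j where
  conn_refl: "has_level u \<Longrightarrow> level u \<le> j \<Longrightarrow> conn j u u"
| conn_step: "conn j u w \<Longrightarrow> e \<in> E \<Longrightarrow> en e = {w, x} \<Longrightarrow> level x \<le> j \<Longrightarrow> conn j u x"

lemma connD: "conn j u w \<Longrightarrow> has_level u \<and> level u \<le> j \<and> has_level w \<and> level w \<le> j"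
  by (induction rule: conn.induct) (auto intro: edge_step)

lemma conn_trans: "conn j v w \<Longrightarrow> conn j u v \<Longrightarrow> conn j u w"
  by (induction rule: conn.induct) (auto intro: conn_step)

lemma conn_sym: "conn j u w \<Longrightarrow> conn j w u"
proof (induction rule: conn.induct)
  case (conn_step u w e x)
  have "has_level x" using edge_step(1) connD[OF conn_step(1)] conn_step by blast
  then have "conn j x x" using conn_step conn_refl by blast
  moreover have "en e = {x, w}" using conn_step by auto
  ultimately have "conn j x w" using conn.conn_step connD[OF conn_step(1)] conn_step by blast
  then show ?case using conn_trans conn_step by blast
qed (auto intro: conn_refl)

text \<open>The vertices of level \<open>j\<close> in a component of \<open>{v. level v \<le> j}\<close> may be identified without
  shortening any join.\<close>

lemma conn_eqv:
  "conn j z z' \<Longrightarrow> level z = j \<Longrightarrow> level z' = j \<Longrightarrow> eqv z z'"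
proof (induction j arbitrary: z z')
  case 0
  from 0 show ?case
  proof (cases rule: conn.cases)
    case (conn_step w e)
    then show ?thesis using connD[OF conn_step(1)] edge_levels[of w e z'] 0 by auto
  qed (auto intro: eqv_refl)
next
  case (Suc j)
  have "(level w = Suc j \<longrightarrow> eqv z w) \<and>
      (level w \<le> j \<longrightarrow> (\<exists>d y e. eqv z d \<and> has_level d \<and> level d = Suc j \<and> e \<in> E \<and> en e = {y, d} \<and> level y = j \<and> conn j y w))"
    if "conn (Suc j) z w" for w
    using that Suc.prems(2)
  proof (induction rule: conn.induct)
    case (conn_refl u)
    then show ?case by (auto intro: eqv_refl)
  next
    case (conn_step u w e x)
    have few: "has_level w" "level w \<le> Suc j" "has_level u" using connD[OF conn_step(1)] by auto
    have fex: "has_level x" using edge_step few conn_step by blast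
    have lev: "level x = level w + 1 \<or> level w = level x + 1" using edge_levels few conn_step by blast
    show ?case
    proof (cases "level w = Suc j")
      case True
      then have x: "level x = j" using lev conn_step by auto
      have "eqv u w" using conn_step True by auto
      moreover have "conn j x x" using fex x conn_refl by auto
      moreover have "en e = {x, w}" using conn_step by auto
      ultimately show ?thesis using x True few conn_step by auto
    next
      case False
      then have "level w \<le> j" using few by auto
      then obtain d y e' where d: "eqv u d" "has_level d" "level d = Suc j" "e' \<in> E" "en e' = {y, d}" "level y = j" "conn j y w"
        using conn_step by blast
      show ?thesis
      proof (cases "level x \<le> j")
        case True
        then have "conn j y x" using d conn_step conn.conn_step by blast
        then show ?thesis using d True by auto
      next
        case False
        then have x: "level x = Suc j" "level w = j" using lev conn_step \<open>level w \<le> j\<close> by auto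
        have "eqv y w" using Suc.IH[OF d(7) d(6) x(2)] .
        then have "eqv d x"
          using eqv_up[of y w e' d e x] connD[OF d(7)] d(4-6) x d(3) conn_step.hyps(2,3) by simp
        then have "eqv u x" using eqv_trans[OF d(1) _ d(2)] d(3) x(1) conn_step.prems by simp
        then show ?thesis using x by auto
      qed
    qed
  qed
  then show ?case using Suc.prems by auto
qed

lemma crossing_ends:
  assumes "e \<in> E" "conn j u z" "\<not> conn j u d" "en e = {z, d}"
  shows "level z = j \<and> level d = j + 1"
proof -
  have "\<not> level d \<le> j" using assms conn_step by blast
  then show ?thesis using edge_levels[OF _ assms(1,4)] connD[OF assms(2)] by linarith
qed

lemma crossing_cases:
  assumes "e \<in> crossing J (Collect (conn j u))" "J \<subseteq> E"
  obtains z d where "e \<in> J" "e \<in> E" "en e = {z, d}" "conn j u z" "\<not> conn j u d" "level z = j" "level d = j + 1" "has_level z"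
proof -
  have e: "e \<in> J" "e \<in> E" "card (en e \<inter> Collect (conn j u)) = 1" using assms by (auto simp: crossing_def)
  obtain a b where ab: "en e = {a, b}" "a \<noteq> b" using en_cases e by blast
  then have "(conn j u a \<and> \<not> conn j u b) \<or> (conn j u b \<and> \<not> conn j u a)"
    using e(3) by (cases "conn j u a"; cases "conn j u b") auto
  then show ?thesis
  proof
    assume "conn j u a \<and> \<not> conn j u b"
    then show ?thesis using that[of a b] e ab crossing_ends[of e j u a b] connD[of j u a] by auto
  next
    assume "conn j u b \<and> \<not> conn j u a"
    moreover have "en e = {b, a}" using ab by auto
    ultimately show ?thesis using that[of b a] e crossing_ends[of e j u b a] connD[of j u b] by auto
  qed
qed

lemma joins_remove:
  assumes "joins U J" "e \<in> J" "en e = {a, b}"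
  shows "joins (U \<oplus> ({a} \<oplus> {b})) (J - {e})" "card J = card (J - {e}) + 1"
proof -
  have "e \<in> E" using assms by (auto simp: joins_def)
  moreover have "J \<oplus> {e} = J - {e}" using assms(2) by auto
  ultimately show "joins (U \<oplus> ({a} \<oplus> {b})) (J - {e})" using joins_edge(1)[OF assms(1) _ assms(3)] by metis
  show "card J = card (J - {e}) + 1" using card_Suc_Diff1[OF joins_finite[OF assms(1)] assms(2)] by simp
qed

lemma crossing_at_most_one:
  assumes F: "joins (S \<oplus> {v}) F" "card F = level v"
    and e: "e \<in> crossing F (Collect (conn j u))" and e': "e' \<in> crossing F (Collect (conn j u))"
  shows "e = e'"
proof (rule ccontr)
  assume ne: "e \<noteq> e'"
  have FE: "F \<subseteq> E" using F by (simp add: joins_def)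
  obtain z d where z: "e \<in> F" "e \<in> E" "en e = {z, d}" "conn j u z" "level z = j" "level d = j + 1" "has_level z"
    using crossing_cases[OF e FE] by metis
  obtain z' d' where z': "e' \<in> F" "e' \<in> E" "en e' = {z', d'}" "conn j u z'" "level z' = j" "level d' = j + 1" "has_level z'"
    using crossing_cases[OF e' FE] by metis
  have "conn j z z'" using conn_trans conn_sym z(4) z'(4) by blast
  then have eqz: "eqv z z'" using conn_eqv z z' by auto
  then have eqd: "eqv d d'" using eqv_up z z' by simp
  obtain G where G: "joins (S \<oplus> {z'}) G" "card G = j" using level_attained[OF z'(7)] z' by metis
  define J where "J = F - {e} - {e'}"
  have "e' \<in> F - {e}" using z' ne by simp
  note rem = joins_remove[OF F(1) z(1,3)] joins_remove[OF joins_remove(1)[OF F(1) z(1,3)] this z'(3)]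
  have J: "joins (S \<oplus> {v} \<oplus> ({z} \<oplus> {d}) \<oplus> ({z'} \<oplus> {d'})) J" "level v = card J + 2"
    unfolding J_def using rem F(2) by simp_all
  have "S \<oplus> {v} \<oplus> ({z} \<oplus> {d}) \<oplus> ({z'} \<oplus> {d'}) \<oplus> (S \<oplus> {z'}) = {z} \<oplus> {d} \<oplus> {d'} \<oplus> {v}"
    by (simp add: sdiff_ac)
  from exchange4[OF J(1) G(1) this] obtain w K K' where w: "w = d \<or> w = d' \<or> w = v"
    and K: "joins (S \<oplus> {v} \<oplus> ({z} \<oplus> {d}) \<oplus> ({z'} \<oplus> {d'}) \<oplus> ({z} \<oplus> {w})) K"
    and K': "joins (S \<oplus> {z'} \<oplus> ({z} \<oplus> {w})) K'"
    and sum: "card K + card K' = card J + card G" .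
  have "level w \<le> card K'" using K' by (intro eqvD[OF eqz]) (auto simp: sdiff_ac)
  moreover
  { assume "w = d"
    then have "level v \<le> card (K \<oplus> {e'})" using joins_edge(1)[OF K z'(2,3)] by (intro level_le) (auto simp: sdiff_ac)
    then have "level v \<le> card K + 1" using joins_edge(2)[OF K z'(2,3)] by simp }
  moreover
  { assume "w = d'"
    then have "level v \<le> card (K \<oplus> {e})" using joins_edge(1)[OF K z(2,3)]
      by (intro eqvD[OF eqz]) (auto simp: sdiff_ac)
    then have "level v \<le> card K + 1" using joins_edge(2)[OF K z(2,3)] by simp }
  moreover
  { assume "w = v"
    then have "level z' \<le> card K" using K by (intro eqvD[OF eqd]) (auto simp: sdiff_ac) }
  ultimately show False using w sum J(2) G(2) z z' by auto
qed

lemma finite_crossing: "J \<subseteq> E \<Longrightarrow> finite (crossing J D)"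
  using finE finite_subset by (fastforce simp: crossing_def)

lemma crossing_card:
  assumes F: "joins (S \<oplus> {v}) F" "card F = level v" and s: "conn j u s" "level s = j"
  shows "card (crossing F (Collect (conn j u))) = (if conn j u v then 0 else 1)"
proof -
  let ?D = "Collect (conn j u)"
  have le1: "card (crossing F ?D) \<le> 1" if "joins (S \<oplus> {v}) F" "card F = level v" for v F
    using crossing_at_most_one[OF that, of _ j u] finite_crossing[of F ?D] that(1)
    by (auto simp: card_le_Suc0_iff_eq joins_def)
  obtain G where G: "joins (S \<oplus> {s}) G" "card G = j" using level_attained connD[OF s(1)] s(2) by metis
  have "crossing G ?D = {}"
  proof (rule ccontr)
    assume "crossing G ?D \<noteq> {}"
    then obtain e where e: "e \<in> crossing G ?D" by auto
    have GE: "G \<subseteq> E" using G by (simp add: joins_def)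
    obtain z c where z: "e \<in> G" "en e = {z, c}" "conn j u z" "level z = j" "level c = j + 1"
      using crossing_cases[OF e GE] by metis
    have "eqv s z" using conn_eqv[of j s z] conn_trans conn_sym s z by blast
    then have "level c \<le> card (G - {e})" using joins_remove(1)[OF G(1) z(1,2)]
      by (rule eqvD) (simp add: sdiff_ac)
    then show False using joins_remove(2)[OF G(1) z(1,2)] G(2) z(5) by linarith
  qed
  then have evs: "even (card ((S \<oplus> {s}) \<inter> ?D))"
    using parity_crossing[of G ?D] G by (auto simp: joins_def)
  have "(S \<oplus> {v}) \<inter> ?D = ((S \<oplus> {s}) \<inter> ?D) \<oplus> ({s} \<oplus> ({v} \<inter> ?D))"
    using s(1) by auto
  moreover have "finite (S \<oplus> {s})" using finite_boundary G unfolding joins_def by metis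
  ultimately have "odd (card ((S \<oplus> {v}) \<inter> ?D)) \<longleftrightarrow> odd (card ({s} \<oplus> ({v} \<inter> ?D)))"
    using evs by (simp add: odd_card_sdiff)
  also have "\<dots> \<longleftrightarrow> \<not> conn j u v"
    by (subst odd_card_sdiff) auto
  finally have "odd (card (crossing F ?D)) \<longleftrightarrow> \<not> conn j u v"
    using parity_crossing[of F ?D] F(1) by (auto simp: joins_def)
  then show ?thesis using le1[OF F] by (cases "card (crossing F ?D)") auto
qed

lemma conn_all:
  assumes "\<And>e w. e \<in> E \<Longrightarrow> w \<in> en e \<Longrightarrow> level w \<le> j" "has_level z" "level z \<le> j" "has_level z'"
  shows "conn j z z'"
proof (rule ccontr)
  assume n: "\<not> conn j z z'"
  obtain J J' where J: "joins (S \<oplus> {z}) J" "joins (S \<oplus> {z'}) J'" using assms level_attained by metis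
  have "(S \<oplus> {z}) \<oplus> (S \<oplus> {z'}) = {z} \<oplus> {z'}" by (simp add: sdiff_ac)
  then have boundary: "J \<oplus> J' \<subseteq> E" "boundary en (J \<oplus> J') = {z} \<oplus> {z'}" using joins_sdiff[OF J] by (auto simp: joins_def)
  have zz: "conn j z z" using assms conn_refl by blast
  have "even (card (boundary en (J \<oplus> J') \<inter> Collect (conn j z)))"
  proof (rule closed_boundary_even[OF boundary(1)])
    fix e a b assume "e \<in> J \<oplus> J'" "en e = {a, b}" "a \<in> Collect (conn j z)"
    then show "b \<in> Collect (conn j z)" using assms(1)[of e b] boundary(1) conn_step[of j z a e b] by auto
  qed
  moreover have "({z} \<oplus> {z'}) \<inter> Collect (conn j z) = {z}" using n zz by auto
  ultimately show False using boundary by simp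
qed

lemma odd_level_set:
  assumes Z: "\<And>z. z \<in> Z \<Longrightarrow> has_level z \<and> level z = j" and pair: "\<And>z z'. z \<in> Z \<Longrightarrow> z' \<in> Z \<Longrightarrow> eqv z z'"
    and U: "finite U" "U \<subseteq> Z" "odd (card U)" and J: "joins (S \<oplus> U) J"
  shows "j \<le> card J"
proof -
  obtain z where z: "z \<in> U" using U by (metis card.empty even_zero ex_in_conv)
  obtain F where F: "joins (S \<oplus> {z}) F" "card F = j" using Z level_attained z U by (metis subsetD)
  have "S \<oplus> U = (S \<oplus> {z}) \<oplus> (U - {z})" using z by auto
  then have J': "joins ((S \<oplus> {z}) \<oplus> (U - {z})) J" using J by metis
  show ?thesis
  proof (rule extreme_even_set[OF F, of Z "U - {z}"])
    show "j \<le> card J" if "joins (S \<oplus> {z}) J" for J using level_le[OF that] Z z U by auto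
    show "j \<le> card J" if "p \<in> Z" "q \<in> Z" "joins (S \<oplus> {z} \<oplus> ({p} \<oplus> {q})) J" for p q J
    proof -
      have "level z \<le> card J" by (rule eqvD[OF pair[OF that(1,2)] that(3)]) (simp add: sdiff_ac)
      then show ?thesis using Z z U by auto
    qed
  qed (use U z J' in auto)
qed

end

lemma (in multigraph) patch:
  assumes Q: "Q \<subseteq> E" "\<And>e. e \<in> Q \<Longrightarrow> en e \<subseteq> D" and J: "joins U J" "crossing J D = {}"
  shows "joins (boundary en Q \<oplus> (U - D)) (Q \<oplus> inside J (- D))"
    and "card (Q \<oplus> inside J (- D)) \<le> card Q + card (inside J (- D))"
proof -
  have JE: "J \<subseteq> E" using J by (simp add: joins_def)
  have "crossing J (- D) = {}"
  proof -
    { fix e assume e: "e \<in> J" "card (en e \<inter> - D) = 1"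
      obtain a b where "en e = {a, b}" "a \<noteq> b" using en_cases e JE by blast
      then have "card (en e \<inter> D) = 1" using e(2) by (cases "a \<in> D"; cases "b \<in> D") auto
      then have False using J(2) e by (auto simp: crossing_def) }
    then show ?thesis by (auto simp: crossing_def)
  qed
  then have "boundary en (inside J (- D)) = U - D"
    using boundary_inside[OF JE, of "- D"] J by (auto simp: joins_def)
  then have "joins (U - D) (inside J (- D))" using JE by (auto simp: joins_def inside_def)
  then show "joins (boundary en Q \<oplus> (U - D)) (Q \<oplus> inside J (- D))" using joins_sdiff[OF joins_subset[OF Q(1)]] by blast
  have "finite Q" "finite (inside J (- D))" using finite_subset[OF Q(1) finE] finite_subset[OF JE finE] by (auto simp: inside_def)
  then show "card (Q \<oplus> inside J (- D)) \<le> card Q + card (inside J (- D))" by (rule card_sdiff_le)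
qed

lemma (in multigraph) no_crossing:
  assumes J: "joins U J" "crossing J D = {}"
  shows "boundary en (inside J D) = U \<inter> D" "card J = card (inside J D) + card (inside J (- D))"
proof -
  have JE: "J \<subseteq> E" using J by (simp add: joins_def)
  show "boundary en (inside J D) = U \<inter> D"
    using boundary_inside[OF JE, of D] J by (auto simp: joins_def)
  have "J = inside J D \<oplus> inside J (- D)" using split_by[OF JE, of D] J by (simp add: sdiff_ac)
  moreover have "inside J D \<inter> inside J (- D) = {}"
  proof -
    have "en e \<noteq> {}" if "e \<in> J" for e using card2[of e] JE that by force
    then show ?thesis by (fastforce simp: inside_def)
  qed
  ultimately have "J = inside J D \<union> inside J (- D)" "inside J D \<inter> inside J (- D) = {}"
    unfolding sdiff_def by blast+
  moreover have "finite (inside J D)" "finite (inside J (- D))" using finite_subset[OF JE finE] by (auto simp: inside_def)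
  ultimately show "card J = card (inside J D) + card (inside J (- D))" by (metis card_Un_disjoint)
qed

lemma (in levels) conn_level:
  assumes "has_level u" "level u \<le> j" "has_level w" "\<not> conn j u w"
  obtains s where "conn j u s" "level s = j"
proof (rule ccontr)
  assume no: "\<not> thesis"
  obtain J J' where J: "joins (S \<oplus> {u}) J" "joins (S \<oplus> {w}) J'" using assms level_attained by metis
  have "(S \<oplus> {u}) \<oplus> (S \<oplus> {w}) = {u} \<oplus> {w}" by (simp add: sdiff_ac)
  then have boundary: "J \<oplus> J' \<subseteq> E" "boundary en (J \<oplus> J') = {u} \<oplus> {w}" using joins_sdiff[OF J] by (auto simp: joins_def)
  have uu: "conn j u u" using assms conn_refl by blast
  have "crossing (J \<oplus> J') (Collect (conn j u)) = {}"
  proof (rule ccontr)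
    assume "crossing (J \<oplus> J') (Collect (conn j u)) \<noteq> {}"
    then obtain e where "e \<in> crossing (J \<oplus> J') (Collect (conn j u))" by auto
    from crossing_cases[OF this boundary(1)] show False using no that by metis
  qed
  then have "even (card (boundary en (J \<oplus> J') \<inter> Collect (conn j u)))" using parity_crossing[OF boundary(1)] by simp
  moreover have "({u} \<oplus> {w}) \<inter> Collect (conn j u) = {u}" using assms uu by auto
  ultimately show False using boundary by simp
qed

section \<open>Distances in terms of joins\<close>

lemma bipartite_levels:
  assumes "bipartite_graft K"
  shows "levels (edges K) (ends K) (colA K)"
proof
  show "finite (edges K)" using assms by (simp add: bipartite_graft_def is_graft_def fin_mgraph_def)
  fix e assume e: "e \<in> edges K"
  then show "card (ends K e) = 2" using assms by (simp add: bipartite_graft_def is_graft_def fin_mgraph_def)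
  obtain a b where "a \<in> colA K" "b \<in> colB K" "ends K e = {a, b}"
    using assms e unfolding bipartite_graft_def by blast
  moreover have "colA K \<inter> colB K = {}" using assms by (simp add: bipartite_graft_def)
  ultimately have "ends K e \<inter> colA K = {a}" by auto
  then show "card (ends K e \<inter> colA K) = 1" by simp
qed

locale graft_join = multigraph "edges G" "ends G" for G :: "('v, 'e, 'z) graft_scheme" +
  assumes graft: "is_graft G"
begin

lemma ends_verts: "e \<in> edges G \<Longrightarrow> ends G e \<subseteq> verts G"
  using graft by (simp add: is_graft_def fin_mgraph_def)

lemma is_join_iff: "is_join G F \<longleftrightarrow> joins (terms G) F"
proof -
  have "boundary (ends G) F \<subseteq> verts G" if "F \<subseteq> edges G" for F
    using ends_verts that by (intro order_trans[OF boundary_subset] UN_least) auto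
  moreover have "terms G \<subseteq> verts G" using graft by (simp add: is_graft_def)
  moreover have "odd (card {e \<in> F. v \<in> ends G e}) \<longleftrightarrow> v \<in> boundary (ends G) F" for v by (simp add: boundary_def)
  ultimately show ?thesis unfolding is_join_def joins_def by blast
qed

lemma minimum_join_iff: "minimum_join G F \<longleftrightarrow> joins (terms G) F \<and> card F = tau (terms G)"
proof
  assume F: "minimum_join G F"
  then have 1: "joins (terms G) F" by (simp add: minimum_join_def is_join_iff)
  then obtain J where "joins (terms G) J" "card J = tau (terms G)"
    using tau_attained feasible_def by metis
  then show "joins (terms G) F \<and> card F = tau (terms G)"
    using F tau_le[OF 1] 1 by (auto simp: minimum_join_def is_join_iff intro: antisym)
next
  assume "joins (terms G) F \<and> card F = tau (terms G)"
  then show "minimum_join G F" using tau_le by (simp add: minimum_join_def is_join_iff)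
qed

lemma minimum_join_exists: "has_join G \<Longrightarrow> \<exists>F. minimum_join G F"
  unfolding minimum_join_iff has_join_def is_join_iff using tau_attained feasible_def by metis

lemma is_path_boundary: "is_path G x vs es y \<Longrightarrow> set es \<subseteq> edges G \<and> boundary (ends G) (set es) = {x} \<oplus> {y}"
proof (induction es arbitrary: x vs)
  case Nil
  then have "length vs = 1" by (simp add: is_path_def)
  then have "x = y" using Nil by (cases vs) (auto simp: is_path_def)
  then show ?case by (simp add: sdiff_ac)
next
  case (Cons e es)
  from Cons.prems obtain u us where vs: "vs = x # u # us"
    by (cases vs; cases "tl vs") (auto simp: is_path_def)
  have "\<forall>i<length (e # es). (e # es) ! i \<in> edges G \<and> ends G ((e # es) ! i) = {vs ! i, vs ! Suc i}"
    using Cons.prems by (simp add: is_path_def)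
  then have st: "\<And>i. i < length (e # es) \<Longrightarrow> (e # es) ! i \<in> edges G \<and> ends G ((e # es) ! i) = {vs ! i, vs ! Suc i}"
    by blast
  have e: "e \<in> edges G" "ends G e = {x, u}" using st[of 0] vs by auto
  have st': "es ! i \<in> edges G \<and> ends G (es ! i) = {(u # us) ! i, us ! i}" if "i < length es" for i
    using st[of "Suc i"] that vs by simp
  have p: "is_path G u (u # us) es y" using Cons.prems vs st' by (auto simp: is_path_def)
  then have IH: "set es \<subseteq> edges G" "boundary (ends G) (set es) = {u} \<oplus> {y}" using Cons.IH by auto
  have "e \<notin> set es"
  proof
    assume "e \<in> set es"
    then obtain i where i: "i < length es" "es ! i = e" by (auto simp: in_set_conv_nth)
    then have "x \<in> {(u # us) ! i, us ! i}" using st'[of i] e by auto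
    moreover have "length us = length es" using Cons.prems vs by (simp add: is_path_def)
    ultimately have "x \<in> set (u # us)" using i by (auto simp: nth_Cons' split: if_splits)
    then show False using Cons.prems vs by (auto simp: is_path_def)
  qed
  then have "set (e # es) = set es \<oplus> {e}" by auto
  moreover have "joins ({u} \<oplus> {y} \<oplus> ({x} \<oplus> {u})) (set es \<oplus> {e})"
    using joins_edge(1)[of _ "set es" e x u] IH e by (auto simp: joins_def)
  ultimately show ?case by (auto simp: joins_def sdiff_ac)
qed

lemma is_path_snoc:
  assumes p: "is_path G x vs es y" and e: "e \<in> edges G" "ends G e = {y, u}" and u: "u \<notin> set vs"
  shows "is_path G x (vs @ [u]) (es @ [e]) u"
proof -
  have len: "length vs = Suc (length es)" "last vs = y" "vs \<noteq> []" using p by (auto simp: is_path_def)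
  then have "vs ! length es = y" by (simp add: last_conv_nth)
  then show ?thesis using assms len ends_verts[OF e(1)]
    by (auto simp: is_path_def nth_append less_Suc_eq)
qed

lemma is_path_take:
  assumes p: "is_path G x vs es y" and i: "i < length vs"
  shows "is_path G x (take (Suc i) vs) (take i es) (vs ! i)"
proof -
  have len: "length vs = Suc (length es)" "vs \<noteq> []" using p by (auto simp: is_path_def)
  have "last (take (Suc i) vs) = vs ! i" using i len by (simp add: take_Suc_conv_app_nth)
  then show ?thesis using p i len set_take_subset[of "Suc i" vs]
    by (auto simp: is_path_def)
qed

lemma path_in_join:
  assumes J: "J \<subseteq> edges G" "boundary (ends G) J = {x} \<oplus> {y}" and x: "x \<in> verts G"
  obtains vs es where "is_path G x vs es y" "set es \<subseteq> J"
proof -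
  define R where "R = {w. \<exists>vs es. is_path G x vs es w \<and> set es \<subseteq> J}"
  have xR: "x \<in> R" unfolding R_def using x
    by (intro CollectI exI[of _ "[x]"] exI[of _ "[]"]) (simp add: is_path_def)
  have "even (card (boundary (ends G) J \<inter> R))"
  proof (rule closed_boundary_even[OF J(1)])
    fix e a b assume e: "e \<in> J" "ends G e = {a, b}" "a \<in> R"
    then obtain vs es where p: "is_path G x vs es a" "set es \<subseteq> J" by (auto simp: R_def)
    show "b \<in> R"
    proof (cases "b \<in> set vs")
      case True
      then obtain i where i: "i < length vs" "vs ! i = b" by (auto simp: in_set_conv_nth)
      have "set (take i es) \<subseteq> J" using p(2) set_take_subset[of i es] by simp
      then show ?thesis using is_path_take[OF p(1) i(1)] i(2) unfolding R_def by auto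
    next
      case False
      then show ?thesis using is_path_snoc[OF p(1) _ e(2)] e p J unfolding R_def
        by (auto intro!: exI[of _ "vs @ [b]"] exI[of _ "es @ [e]"])
    qed
  qed
  then have "y \<in> R" unfolding J(2) using xR
    by (cases "x = y"; cases "y \<in> R") (auto simp: sdiff_def Int_insert_left insert_Diff_if)
  then show ?thesis using that by (auto simp: R_def)
qed

lemma weight_eq: "int (card (F \<oplus> P)) = int (card F) + weight F P" if "finite F" "finite P"
proof -
  have "card P = card (P \<inter> F) + card (P - F)" using card_Int_Diff[OF that(2)] by simp
  then show ?thesis using card_sdiff[OF that] unfolding weight_def by (simp add: Int_commute)
qed

lemma path_iff_join:
  assumes F: "minimum_join G F" and x: "x \<in> verts G"
  shows "(\<exists>vs es. is_path G x vs es y \<and> weight F (set es) \<le> k) \<longleftrightarrow>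
    (\<exists>J. joins (terms G \<oplus> {x} \<oplus> {y}) J \<and> int (card J) \<le> int (tau (terms G)) + k)"
proof
  have F': "joins (terms G) F" "card F = tau (terms G)" using F minimum_join_iff by auto
  note fF = joins_finite[OF F'(1)]
  { assume "\<exists>vs es. is_path G x vs es y \<and> weight F (set es) \<le> k"
    then obtain vs es where p: "is_path G x vs es y" "weight F (set es) \<le> k" by auto
    have "joins ({x} \<oplus> {y}) (set es)" using is_path_boundary[OF p(1)] by (simp add: joins_def)
    from joins_sdiff[OF F'(1) this] have "joins (terms G \<oplus> {x} \<oplus> {y}) (F \<oplus> set es)" by (simp add: sdiff_assoc)
    then show "\<exists>J. joins (terms G \<oplus> {x} \<oplus> {y}) J \<and> int (card J) \<le> int (tau (terms G)) + k"
      using weight_eq[OF fF, of "set es"] p(2) F'(2) by auto }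
  { assume "\<exists>J. joins (terms G \<oplus> {x} \<oplus> {y}) J \<and> int (card J) \<le> int (tau (terms G)) + k"
    then obtain J where J: "joins (terms G \<oplus> {x} \<oplus> {y}) J" "int (card J) \<le> int (tau (terms G)) + k" by auto
    have d: "joins ({x} \<oplus> {y}) (F \<oplus> J)" using joins_sdiff[OF F'(1) J(1)] by (simp add: sdiff_ac)
    then obtain vs es where p: "is_path G x vs es y" "set es \<subseteq> F \<oplus> J"
      using path_in_join[of "F \<oplus> J" x y] x unfolding joins_def by metis
    have es: "joins ({x} \<oplus> {y}) (set es)" using is_path_boundary[OF p(1)] by (simp add: joins_def)
    have "joins (terms G) (J \<oplus> set es)" using joins_sdiff[OF J(1) es] by (simp add: sdiff_ac)
    then have "tau (terms G) \<le> card (J \<oplus> set es)" by (rule tau_le)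
    moreover have "card (F \<oplus> set es) + card (J \<oplus> set es) = card F + card J"
      using card_exchange[OF fF joins_finite[OF J(1)] p(2)] .
    ultimately have "weight F (set es) \<le> k" using weight_eq[OF fF, of "set es"] J(2) F'(2) by simp
    then show "\<exists>vs es. is_path G x vs es y \<and> weight F (set es) \<le> k" using p by auto }
qed

lemma lambda_iff:
  assumes hj: "has_join G" and x: "x \<in> verts G"
  shows "lambda G x y < 0 \<longleftrightarrow> (\<exists>J. joins (terms G \<oplus> {x} \<oplus> {y}) J \<and> card J < tau (terms G))" (is "?A \<longleftrightarrow> ?A'")
    and "lambda G x y \<le> 0 \<longleftrightarrow> (\<exists>J. joins (terms G \<oplus> {x} \<oplus> {y}) J \<and> card J \<le> tau (terms G))" (is "?B \<longleftrightarrow> ?B'")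
proof -
  define F where "F = (SOME F. minimum_join G F)"
  have F: "minimum_join G F" unfolding F_def using minimum_join_exists[OF hj] by (rule someI_ex)
  let ?P = "\<lambda>k. \<exists>vs es. is_path G x vs es y \<and> weight F (set es) \<le> k"
  have lam: "lambda G x y = (INF (vs, es)\<in>{(vs, es). is_path G x vs es y}. ereal (real_of_int (weight F (set es))))"
    unfolding lambda_def F_def lambda_wrt_def ..
  have less: "lambda G x y < ereal (of_int k) \<longleftrightarrow> ?P (k - 1)" for k
    unfolding lam INF_less_iff by (auto split: prod.splits)
  have 0: "ereal (of_int 0) = 0" "ereal (of_int 1) = 1" by auto
  show "?A \<longleftrightarrow> ?A'" using less[of 0] path_iff_join[OF F x, of y "-1"] unfolding 0 by simp
  have "?B \<longleftrightarrow> ?P 0"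
  proof
    assume ?B
    then have "lambda G x y < 1" using order.strict_trans1[of _ 0 "1::ereal"] by simp
    then show "?P 0" using less[of 1] unfolding 0 by simp
  next
    assume "?P 0"
    then obtain vs es where p: "is_path G x vs es y" "weight F (set es) \<le> 0" by auto
    have "lambda G x y \<le> ereal (of_int (weight F (set es)))"
      unfolding lam using p(1) by (intro INF_lower2[of "(vs, es)"]) auto
    also have "\<dots> \<le> 0" using p(2) by simp
    finally show ?B .
  qed
  then show "?B \<longleftrightarrow> ?B'" using path_iff_join[OF F x, of y 0] by simp
qed

lemma has_join_iff: "has_join G \<longleftrightarrow> feasible (terms G)"
  by (simp add: has_join_def feasible_def is_join_iff)

lemma extreme_iff: "extreme G X \<longleftrightarrow> feasible (terms G) \<and> X \<subseteq> verts G \<and>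
    (\<forall>x\<in>X. \<forall>y\<in>X. \<forall>J. joins (terms G \<oplus> {x} \<oplus> {y}) J \<longrightarrow> tau (terms G) \<le> card J)"
proof -
  have "lambda G x y \<ge> 0 \<longleftrightarrow> (\<forall>J. joins (terms G \<oplus> {x} \<oplus> {y}) J \<longrightarrow> tau (terms G) \<le> card J)"
    if "has_join G" "x \<in> verts G" for x y
    using lambda_iff(1)[OF that, of y] by (auto simp: not_less[symmetric])
  then show ?thesis unfolding extreme_def has_join_iff by blast
qed

lemma neg_set_iff: "has_join G \<Longrightarrow> X \<subseteq> verts G \<Longrightarrow> y \<in> neg_set G X \<longleftrightarrow> y \<in> verts G - X \<and>
    (\<exists>x\<in>X. \<exists>J. joins (terms G \<oplus> {x} \<oplus> {y}) J \<and> card J < tau (terms G))"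
  unfolding neg_set_def using lambda_iff(1) by (simp add: INF_less_iff) (meson subsetD)

lemma primal_iff: "primal G r \<longleftrightarrow> feasible (terms G) \<and> r \<in> verts G \<and>
    (\<forall>x\<in>verts G. \<exists>J. joins (terms G \<oplus> {r} \<oplus> {x}) J \<and> card J \<le> tau (terms G))"
  unfolding primal_def using lambda_iff(2) graft has_join_iff by blast

lemma zero_set_iff:
  assumes "has_join G" "r \<in> verts G"
  shows "x \<in> zero_set G r \<longleftrightarrow> x \<in> verts G \<and>
    (\<exists>J. joins (terms G \<oplus> {r} \<oplus> {x}) J \<and> card J \<le> tau (terms G)) \<and>
    \<not> (\<exists>J. joins (terms G \<oplus> {r} \<oplus> {x}) J \<and> card J < tau (terms G))"
proof -
  have "lambda G r x = 0 \<longleftrightarrow> lambda G r x \<le> 0 \<and> \<not> lambda G r x < 0" by (metis antisym_conv2 order.refl less_irrefl)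
  then show ?thesis unfolding zero_set_def lambda_iff[OF assms, symmetric] by simp
qed

end

lemma bipartite_graft_join:
  assumes "bipartite_graft K"
  shows "graft_join K"
proof -
  interpret levels "edges K" "ends K" "colA K" using bipartite_levels[OF assms] .
  show ?thesis by unfold_locales (use assms in \<open>simp add: bipartite_graft_def\<close>)
qed

section \<open>Spine sets of syntheses\<close>

lemma tooth_facts:
  assumes H: "bipartite_graft H" and pr: "primal H r"
  defines "t \<equiv> multigraph.tau (edges H) (ends H) (terms H)"
  shows "y \<in> verts H \<Longrightarrow> \<exists>N. multigraph.joins (edges H) (ends H) (terms H \<oplus> {r} \<oplus> {y}) N \<and> card N \<le> t"
    and "finite U \<Longrightarrow> U \<subseteq> zero_set H r \<Longrightarrow> odd (card U) \<Longrightarrow>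
      multigraph.joins (edges H) (ends H) (terms H \<oplus> {r} \<oplus> U) J \<Longrightarrow> t \<le> card J"
proof -
  interpret G: graft_join H using bipartite_graft_join[OF H] .
  interpret L: levels "edges H" "ends H" "colA H" "terms H \<oplus> {r}" using bipartite_levels[OF H] .
  have hj: "has_join H" "r \<in> verts H" using pr by (auto simp: primal_def)
  have pr': "\<exists>N. G.joins (terms H \<oplus> {r} \<oplus> {y}) N \<and> card N \<le> t" if "y \<in> verts H" for y
    using pr that unfolding G.primal_iff t_def by blast
  then show "y \<in> verts H \<Longrightarrow> \<exists>N. G.joins (terms H \<oplus> {r} \<oplus> {y}) N \<and> card N \<le> t" .
  have lev: "L.has_level y \<and> L.level y \<le> t" if "y \<in> verts H" for y
    using pr'[OF that] L.level_le order_trans unfolding L.has_level_def G.feasible_def by blast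
  have Z: "z \<in> verts H \<and> L.has_level z \<and> L.level z = t" if "z \<in> zero_set H r" for z
  proof -
    have z: "z \<in> verts H" "\<not> (\<exists>J. G.joins (terms H \<oplus> {r} \<oplus> {z}) J \<and> card J < t)"
      using that G.zero_set_iff[OF hj] unfolding t_def by auto
    then show ?thesis using lev[OF z(1)] L.level_attained by (metis order_le_less)
  qed
  show "finite U \<Longrightarrow> U \<subseteq> zero_set H r \<Longrightarrow> odd (card U) \<Longrightarrow> G.joins (terms H \<oplus> {r} \<oplus> U) J \<Longrightarrow> t \<le> card J"
  proof (rule L.odd_level_set)
    fix z z' assume z: "z \<in> zero_set H r" "z' \<in> zero_set H r"
    have "L.conn t z z'"
      using lev G.ends_verts Z[OF z(1)] Z[OF z(2)] by (intro L.conn_all) auto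
    then show "L.eqv z z'" using L.conn_eqv Z z by blast
  qed (use Z in auto)
qed

locale synthesis_setting =
  fixes K G :: "('v, 'e) bgraft" and H :: "'v \<Rightarrow> ('v, 'e) bgraft" and r :: "'v \<Rightarrow> 'v"
  assumes K: "bipartite_graft K" and G: "comb G" and tooth: "tooth_grafts G H r" and syn: "synthesis K G H r"
begin

abbreviation "A \<equiv> colA G"
abbreviation "B \<equiv> colB G"
abbreviation "V v \<equiv> verts (H v)"
abbreviation "Z v \<equiv> zero_set (H v) (r v)"
definition t :: "'v \<Rightarrow> nat" where "t v = multigraph.tau (edges (H v)) (ends (H v)) (terms (H v))"

sublocale KK: graft_join K using bipartite_graft_join[OF K] .

lemma bipartite_skeleton: "bipartite_graft G" using G by (simp add: comb_def)

sublocale GG: graft_join G using bipartite_graft_join[OF bipartite_skeleton] .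

lemma tooth_graft: "v \<in> B \<Longrightarrow> bipartite_graft (H v)" "v \<in> B \<Longrightarrow> primal (H v) (r v)"
  "v \<in> B \<Longrightarrow> V v \<inter> (A \<union> B) = {}"
  using tooth bipartite_skeleton by (auto simp: tooth_grafts_def bipartite_graft_def)

lemma V_disjoint: "v \<in> B \<Longrightarrow> w \<in> B \<Longrightarrow> x \<in> V v \<Longrightarrow> x \<in> V w \<Longrightarrow> v = w"
  using tooth unfolding tooth_grafts_def disjoint_family_on_def by blast

lemma tooth_subgraph: "v \<in> B \<Longrightarrow> V v \<subseteq> verts K" "v \<in> B \<Longrightarrow> edges (H v) = {e \<in> edges K. ends K e \<subseteq> V v}"
  "v \<in> B \<Longrightarrow> e \<in> edges (H v) \<Longrightarrow> ends (H v) e = ends K e"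
  "v \<in> B \<Longrightarrow> terms K \<inter> V v = terms (H v) \<oplus> {r v}"
  using syn by (auto simp: synthesis_def subgraph_def edges_inside_def sdiff_def)

lemma contraction: "same_graft (contract K B V) G" and BK: "B \<inter> verts K = {}"
  using syn by (auto simp: synthesis_def)

lemma AB: "A \<union> B = verts G" "A \<inter> B = {}" "finite B"
  using bipartite_skeleton by (auto simp: bipartite_graft_def is_graft_def fin_mgraph_def intro: finite_subset)

lemma verts_K: "verts K = A \<union> (\<Union>v\<in>B. V v)" and A_V: "A \<inter> (\<Union>v\<in>B. V v) = {}"
proof -
  define U where "U = (\<Union>v\<in>B. V v)"
  have "(verts K - U) \<union> B = A \<union> B" using contraction AB by (simp add: same_graft_def contract_def U_def)
  moreover have "U \<subseteq> verts K" using tooth_subgraph(1) by (auto simp: U_def)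
  ultimately have "verts K = A \<union> U" using BK AB(2) by blast
  then show "verts K = A \<union> (\<Union>v\<in>B. V v)" by (simp add: U_def)
  show "A \<inter> (\<Union>v\<in>B. V v) = {}" using tooth_graft(3) by blast
qed

lemma edges_G: "edges G = edges K - (\<Union>v\<in>B. edges (H v))"
  and ends_G: "e \<in> edges G \<Longrightarrow> ends G e = contract_vertex B V ` ends K e"
proof -
  show *: "edges G = edges K - (\<Union>v\<in>B. edges (H v))"
    using contraction tooth_subgraph(2) by (simp add: same_graft_def contract_def edges_inside_def)
  show "e \<in> edges G \<Longrightarrow> ends G e = contract_vertex B V ` ends K e"
    using contraction unfolding same_graft_def contract_def by auto
qed

lemma contract_vertex_eq: "v \<in> B \<Longrightarrow> x \<in> V v \<Longrightarrow> contract_vertex B V x = v"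
  "x \<notin> (\<Union>v\<in>B. V v) \<Longrightarrow> contract_vertex B V x = x"
  unfolding contract_vertex_def using V_disjoint by auto

lemma edge_G:
  assumes "e \<in> edges G"
  obtains a b z where "a \<in> A" "b \<in> B" "z \<in> Z b" "z \<in> V b" "ends K e = {a, z}" "ends G e = {a, b}" "e \<in> edges K"
proof -
  have eK: "e \<in> edges K" using assms edges_G by auto
  obtain a b where ab: "a \<in> A" "b \<in> B" "ends G e = {a, b}"
    using bipartite_skeleton assms unfolding bipartite_graft_def by blast
  have im: "contract_vertex B V ` ends K e = {a, b}" using ends_G[OF assms] ab by simp
  have eV: "ends K e \<subseteq> A \<union> (\<Union>v\<in>B. V v)" using KK.ends_verts[OF eK] verts_K by simp
  have "b \<in> contract_vertex B V ` ends K e" "a \<in> contract_vertex B V ` ends K e" using im by auto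
  then obtain p q where p: "p \<in> ends K e" "contract_vertex B V p = b"
    and q: "q \<in> ends K e" "contract_vertex B V q = a" by (elim imageE) auto
  have cases: "contract_vertex B V x = x \<and> x \<in> A \<or> (\<exists>v\<in>B. x \<in> V v \<and> contract_vertex B V x = v)"
    if "x \<in> ends K e" for x
  proof (cases "x \<in> (\<Union>v\<in>B. V v)")
    case True
    then show ?thesis using contract_vertex_eq(1) by auto
  next
    case False
    then show ?thesis using contract_vertex_eq(2) eV that by auto
  qed
  have qa: "q = a" using cases[OF q(1)] q(2) ab(1) AB(2) by auto
  have pb: "p \<in> V b" using cases[OF p(1)] p(2) ab(2) AB(2) by auto
  have ne: "p \<noteq> q" using p q ab AB(2) by auto
  have ends: "ends K e = {a, p}"
    using KK.card2[OF eK] p(1) q(1) ne qa card_subset_eq[of "ends K e" "{a, p}"] card_ge_0_finite[of "ends K e"] by auto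
  have "a \<notin> V b" using tooth_graft(3) ab by blast
  then have "ends K e \<inter> V b = {p}" using ends pb by auto
  then have "e \<in> cut K (V b)" using eK by (simp add: cut_def)
  moreover have "cut K (V b) = edges_between K A (Z b)" using syn ab(2) by (simp add: synthesis_def)
  ultimately obtain y z where yz: "y \<in> A" "z \<in> Z b" "ends K e = {y, z}" by (auto simp: edges_between_def)
  have "z \<in> V b" using yz(2) by (simp add: zero_set_def)
  then have "z = p" using yz(1,3) ends \<open>a \<notin> V b\<close> by (metis doubleton_eq_iff)
  then show ?thesis using that ab ends yz(2) pb eK by blast
qed

definition FG :: "'e set" where "FG = (SOME F. minimum_join G F)"

lemma FG: "minimum_join G FG"
  unfolding FG_def using GG.minimum_join_exists G comb_def by (metis someI_ex)

lemma FG_sub: "FG \<subseteq> edges G" using FG by (simp add: GG.minimum_join_iff GG.joins_def)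

lemma FG_unique: "v \<in> B \<Longrightarrow> \<exists>!e. e \<in> FG \<and> v \<in> ends G e"
proof -
  assume "v \<in> B"
  then have "card (cut G {v} \<inter> FG) = 1" using G FG by (simp add: comb_def)
  then obtain e where e: "cut G {v} \<inter> FG = {e}" by (auto simp: card_1_singleton_iff)
  have "e' \<in> cut G {v} \<longleftrightarrow> v \<in> ends G e'" if "e' \<in> FG" for e'
    using that FG_sub by (cases "v \<in> ends G e'") (auto simp: cut_def)
  then have "e' \<in> FG \<and> v \<in> ends G e' \<longleftrightarrow> e' = e" for e' using e by auto
  then show ?thesis by (intro ex1I[of _ e]) auto
qed

lemma tooth_terms_odd: "v \<in> B \<Longrightarrow> odd (card (terms K \<inter> V v))"
proof -
  assume v: "v \<in> B"
  obtain e where "e \<in> FG" "v \<in> ends G e" "\<And>e'. e' \<in> FG \<and> v \<in> ends G e' \<Longrightarrow> e' = e"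
    using FG_unique[OF v] by blast
  then have "{e \<in> FG. v \<in> ends G e} = {e}" by blast
  then have "v \<in> boundary (ends G) FG" by (simp add: boundary_def)
  then have "v \<in> terms G" using FG by (simp add: GG.minimum_join_iff GG.joins_def)
  moreover have "terms G = (terms K - (\<Union>v\<in>B. V v)) \<union> {v \<in> B. odd (card (V v \<inter> terms K))}"
    using contraction by (simp add: same_graft_def contract_def)
  moreover have "v \<notin> terms K" using BK v KK.graft by (auto simp: is_graft_def)
  ultimately show ?thesis by (simp add: Int_commute)
qed

lemma joins_H: "v \<in> B \<Longrightarrow> multigraph.joins (edges (H v)) (ends (H v)) U J \<longleftrightarrow> J \<subseteq> edges (H v) \<and> boundary (ends K) J = U"
  unfolding GG.joins_def multigraph.joins_def[OF graft_join.axioms(1)[OF bipartite_graft_join[OF tooth_graft(1)]]]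
  using boundary_cong[of J "ends (H v)" "ends K"] tooth_subgraph(3) by (metis subsetD)

lemma edge_part: "e \<in> edges K \<Longrightarrow> \<exists>v\<in>B. ends K e \<inter> V v \<noteq> {}"
proof (cases "e \<in> edges G")
  case True
  then obtain a b z where "b \<in> B" "z \<in> V b" "ends K e = {a, z}" using edge_G by metis
  then show ?thesis by auto
next
  case False
  assume e: "e \<in> edges K"
  then obtain v where v: "v \<in> B" "e \<in> edges (H v)" using False edges_G by auto
  then have "ends K e \<subseteq> V v" using tooth_subgraph(2) by auto
  moreover have "ends K e \<noteq> {}" using KK.card2[OF e] by force
  ultimately show ?thesis using v by blast
qed

lemma edge_part_unique: "e \<in> edges K \<Longrightarrow> v \<in> B \<Longrightarrow> w \<in> B \<Longrightarrow> ends K e \<inter> V v \<noteq> {} \<Longrightarrow> ends K e \<inter> V w \<noteq> {} \<Longrightarrow> v = w"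
proof (cases "e \<in> edges G")
  case True
  assume *: "v \<in> B" "w \<in> B" "ends K e \<inter> V v \<noteq> {}" "ends K e \<inter> V w \<noteq> {}"
  obtain a b z where ab: "a \<in> A" "b \<in> B" "z \<in> V b" "ends K e = {a, z}" using edge_G[OF True] by metis
  have "a \<notin> V v" "a \<notin> V w" using tooth_graft(3)[OF *(1)] tooth_graft(3)[OF *(2)] ab(1) by auto
  then have "z \<in> V v" "z \<in> V w" using *(3,4) ab(4) by auto
  then show ?thesis using V_disjoint * by blast
next
  case False
  assume *: "v \<in> B" "w \<in> B" "ends K e \<inter> V v \<noteq> {}" "ends K e \<inter> V w \<noteq> {}" "e \<in> edges K"
  then obtain u where u: "u \<in> B" "e \<in> edges (H u)" using False edges_G by auto
  then have "ends K e \<subseteq> V u" using tooth_subgraph(2) by auto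
  then have "u = v" "u = w" using V_disjoint * u by blast+
  then show ?thesis by simp
qed

lemma card_parts:
  assumes "J \<subseteq> edges K"
  shows "card J = (\<Sum>v\<in>B. card (KK.inside J (V v)) + card (KK.crossing J (V v)))"
proof -
  have fJ: "finite J" using assms KK.finE finite_subset by blast
  let ?W = "\<lambda>v. {e \<in> J. ends K e \<inter> V v \<noteq> {}}"
  have "\<exists>v\<in>B. ends K e \<inter> V v \<noteq> {}" if "e \<in> J" for e using edge_part assms that by auto
  then have "J = (\<Union>v\<in>B. ?W v)" by auto
  then have "card J = card (\<Union>v\<in>B. ?W v)" by simp
  also have "\<dots> = (\<Sum>v\<in>B. card (?W v))"
  proof (rule card_UN_disjoint)
    show "\<forall>v\<in>B. \<forall>w\<in>B. v \<noteq> w \<longrightarrow> ?W v \<inter> ?W w = {}"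
      using edge_part_unique assms by fastforce
  qed (use AB(3) fJ in auto)
  also have "\<dots> = (\<Sum>v\<in>B. card (KK.inside J (V v)) + card (KK.crossing J (V v)))"
  proof (rule sum.cong)
    fix v
    have "finite (KK.inside J (V v))" "finite (KK.crossing J (V v))"
      using fJ by (auto simp: KK.inside_def KK.crossing_def)
    then show "card (?W v) = card (KK.inside J (V v)) + card (KK.crossing J (V v))"
      unfolding KK.inside_Un_crossing[OF assms, symmetric]
      using KK.inside_Int_crossing[OF assms] by (intro card_Un_disjoint) auto
  qed simp
  finally show ?thesis .
qed

lemma lower_bound:
  assumes J: "KK.joins (terms K \<oplus> {a} \<oplus> {a'}) J" and a: "a \<in> A" "a' \<in> A"
  shows "(\<Sum>v\<in>B. t v + 1) \<le> card J"
proof -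
  have JK: "J \<subseteq> edges K" and bdJ: "boundary (ends K) J = terms K \<oplus> {a} \<oplus> {a'}" using J by (auto simp: KK.joins_def)
  have "t v + 1 \<le> card (KK.inside J (V v)) + card (KK.crossing J (V v))" if v: "v \<in> B" for v
  proof -
    let ?C = "KK.crossing J (V v)"
    have CK: "?C \<subseteq> edges K" using JK by (auto simp: KK.crossing_def)
    have "a \<notin> V v" "a' \<notin> V v" using tooth_graft(3)[OF v] a by auto
    then have bdV: "boundary (ends K) J \<inter> V v = terms K \<inter> V v" unfolding bdJ by auto
    then have odd: "odd (card ?C)" using KK.parity_crossing[OF JK, of "V v"] tooth_terms_odd[OF v] by simp
    define U where "U = boundary (ends K) ?C \<inter> V v"
    have "KK.crossing ?C (V v) = ?C" by (auto simp: KK.crossing_def)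
    then have "odd (card U)" using odd KK.parity_crossing[OF CK, of "V v"] by (simp add: U_def)
    moreover have "finite U" using KK.finite_boundary[OF CK] by (simp add: U_def)
    moreover have "U \<subseteq> Z v"
    proof
      fix z assume "z \<in> U"
      then obtain e where e: "e \<in> ?C" "z \<in> ends K e" "z \<in> V v" 
        using boundary_subset[of "ends K" ?C] by (auto simp: U_def)
      then have "e \<in> cut K (V v)" using JK by (auto simp: KK.crossing_def cut_def)
      moreover have "cut K (V v) = edges_between K A (Z v)" using syn v by (simp add: synthesis_def)
      ultimately obtain y x where "y \<in> A" "x \<in> Z v" "ends K e = {y, x}" by (auto simp: edges_between_def)
      then show "z \<in> Z v" using e tooth_graft(3)[OF v] by auto
    qed
    moreover have "multigraph.joins (edges (H v)) (ends (H v)) (terms (H v) \<oplus> {r v} \<oplus> U) (KK.inside J (V v))"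
      using KK.boundary_inside[OF JK, of "V v"] tooth_subgraph(2)[OF v] tooth_subgraph(4)[OF v] JK bdV
      unfolding joins_H[OF v] U_def by (auto simp: KK.inside_def)
    ultimately have "t v \<le> card (KK.inside J (V v))"
      using tooth_facts(2)[OF tooth_graft(1)[OF v] tooth_graft(2)[OF v]] unfolding t_def by blast
    moreover have "card ?C > 0" using odd by (rule odd_pos)
    ultimately show ?thesis by simp
  qed
  then show ?thesis unfolding card_parts[OF JK] by (rule sum_mono)
qed

lemma tooth_join:
  assumes "v \<in> B" "y \<in> V v"
  obtains N where "N \<subseteq> edges (H v)" "boundary (ends K) N = (terms K \<inter> V v) \<oplus> {y}" "card N \<le> t v"
  using tooth_facts(1)[OF tooth_graft(1)[OF assms(1)] tooth_graft(2)[OF assms(1)] assms(2)] that tooth_subgraph(4)[OF assms(1)] joins_H[OF assms(1)]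
  unfolding t_def by metis

definition eF :: "'v \<Rightarrow> 'e" where "eF v = (THE e. e \<in> FG \<and> v \<in> ends G e)"
definition zF :: "'v \<Rightarrow> 'v" where "zF v = (SOME z. z \<in> V v \<and> z \<in> ends K (eF v))"
definition NF :: "'v \<Rightarrow> 'e set" where
  "NF v = (SOME N. N \<subseteq> edges (H v) \<and> boundary (ends K) N = (terms K \<inter> V v) \<oplus> {zF v} \<and> card N \<le> t v)"
definition FK :: "'e set" where "FK = FG \<union> (\<Union>v\<in>B. NF v)"

lemma eF: assumes "v \<in> B" shows "eF v \<in> FG" "v \<in> ends G (eF v)" "e \<in> FG \<Longrightarrow> v \<in> ends G e \<Longrightarrow> e = eF v"
  using theI'[OF FG_unique[OF assms]] FG_unique[OF assms] unfolding eF_def by blast+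

lemma zF:
  assumes "v \<in> B"
  obtains a where "a \<in> A" "ends K (eF v) = {a, zF v}" "zF v \<in> V v"
proof -
  obtain a b z where ab: "a \<in> A" "b \<in> B" "z \<in> V b" "ends K (eF v) = {a, z}" "ends G (eF v) = {a, b}"
    using edge_G[OF subsetD[OF FG_sub eF(1)[OF assms]]] by metis
  have "b = v" using eF(2)[OF assms] ab AB assms by auto
  then have "z \<in> V v \<and> z \<in> ends K (eF v)" using ab by auto
  then have *: "zF v \<in> V v \<and> zF v \<in> ends K (eF v)" unfolding zF_def by (rule someI)
  moreover have "a \<notin> V v" using tooth_graft(3) assms ab by blast
  ultimately have "zF v = z" using ab by auto
  then show ?thesis using that ab * by blast
qed

lemma NF: assumes "v \<in> B"
  shows "NF v \<subseteq> edges (H v)" "boundary (ends K) (NF v) = (terms K \<inter> V v) \<oplus> {zF v}" "card (NF v) \<le> t v"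
proof -
  obtain N where "N \<subseteq> edges (H v) \<and> boundary (ends K) N = (terms K \<inter> V v) \<oplus> {zF v} \<and> card N \<le> t v"
    using zF tooth_join assms by metis
  then have "NF v \<subseteq> edges (H v) \<and> boundary (ends K) (NF v) = (terms K \<inter> V v) \<oplus> {zF v} \<and> card (NF v) \<le> t v"
    unfolding NF_def by (rule someI)
  then show "NF v \<subseteq> edges (H v)" "boundary (ends K) (NF v) = (terms K \<inter> V v) \<oplus> {zF v}" "card (NF v) \<le> t v"
    by auto
qed

lemma FK_sub: "FK \<subseteq> edges K"
  unfolding FK_def using FG_sub edges_G NF(1) tooth_subgraph(2) by blast

lemma eF_NF: "v \<in> B \<Longrightarrow> eF v \<notin> NF v"
  using eF(1) FG_sub edges_G NF(1) by blast

lemma FK_tooth: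
  assumes v: "v \<in> B" and u: "u \<in> V v"
  shows "{e \<in> FK. u \<in> ends K e} = {e \<in> {eF v} \<oplus> NF v. u \<in> ends K e}"
proof -
  have 1: "e = eF v" if e: "e \<in> FG" "u \<in> ends K e" for e
  proof -
    obtain a b z where ab: "a \<in> A" "b \<in> B" "z \<in> V b" "ends K e = {a, z}" "ends G e = {a, b}"
      using edge_G[OF subsetD[OF FG_sub e(1)]] by metis
    then have "u = z" using e u tooth_graft(3)[OF v] by auto
    then have "b = v" using ab u v V_disjoint by blast
    then show ?thesis using eF(3)[OF v e(1)] ab by auto
  qed
  have 2: "w = v" if "w \<in> B" "e \<in> NF w" "u \<in> ends K e" for w e
    using that NF(1) tooth_subgraph(2) V_disjoint v u by blast
  show ?thesis unfolding FK_def using 1 2 eF(1)[OF v] eF_NF[OF v] v by auto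
qed

lemma FK_spine:
  assumes "a \<in> A"
  shows "{e \<in> FK. a \<in> ends K e} = {e \<in> FG. a \<in> ends G e}"
proof -
  have "a \<notin> ends K e" if "v \<in> B" "e \<in> NF v" for v e
    using that NF(1) tooth_subgraph(2) tooth_graft(3) assms by blast
  moreover have "a \<in> ends K e \<longleftrightarrow> a \<in> ends G e" if e: "e \<in> FG" for e
  proof -
    obtain a' b z where ab: "a' \<in> A" "b \<in> B" "z \<in> V b" "ends K e = {a', z}" "ends G e = {a', b}"
      using edge_G[OF subsetD[OF FG_sub e]] by metis
    then have "z \<noteq> a" "b \<noteq> a" using assms tooth_graft(3) AB(2) by blast+
    then show ?thesis using ab by auto
  qed
  ultimately show ?thesis unfolding FK_def by blast
qed

lemma FK_join: "KK.joins (terms K) FK"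
proof -
  have "u \<in> boundary (ends K) FK \<longleftrightarrow> u \<in> terms K" for u
  proof (cases "u \<in> verts K")
    case False
    then show ?thesis using boundary_subset[of "ends K" FK] FK_sub KK.ends_verts KK.graft by (fastforce simp: is_graft_def)
  next
    case True
    then consider "u \<in> A" | v where "v \<in> B" "u \<in> V v" using verts_K by blast
    then show ?thesis
    proof cases
      case 1
      have "u \<in> boundary (ends K) FK \<longleftrightarrow> u \<in> boundary (ends G) FG" using FK_spine[OF 1] by (simp add: boundary_def)
      also have "\<dots> \<longleftrightarrow> u \<in> terms G" using FG by (simp add: GG.minimum_join_iff GG.joins_def)
      also have "\<dots> \<longleftrightarrow> u \<in> terms K"
        using contraction 1 A_V AB(2) by (auto simp: same_graft_def contract_def)
      finally show ?thesis .
    next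
      case (2 v)
      obtain a where a: "a \<in> A" "ends K (eF v) = {a, zF v}" "zF v \<in> V v" using zF[OF 2(1)] .
      have e: "eF v \<in> edges K" using eF(1)[OF 2(1)] FG_sub edges_G by auto
      have fin: "finite (NF v)" using NF(1)[OF 2(1)] tooth_subgraph(2)[OF 2(1)] KK.finE finite_subset by fastforce
      have "u \<in> boundary (ends K) FK \<longleftrightarrow> u \<in> boundary (ends K) ({eF v} \<oplus> NF v)" using FK_tooth[OF 2] by (simp add: boundary_def)
      also have "\<dots> \<longleftrightarrow> u \<in> ({a} \<oplus> {zF v}) \<oplus> ((terms K \<inter> V v) \<oplus> {zF v})"
        using fin NF(2)[OF 2(1)] KK.en_sdiff[OF e a(2)] by (simp add: boundary_sdiff)
      also have "\<dots> \<longleftrightarrow> u \<in> terms K" using 2 a tooth_graft(3)[OF 2(1)] by auto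
      finally show ?thesis .
    qed
  qed
  then show ?thesis using FK_sub by (auto simp: KK.joins_def)
qed

lemma card_FK: "card FK \<le> (\<Sum>v\<in>B. t v + 1)"
proof -
  have "FG \<subseteq> eF ` B"
  proof
    fix e assume e: "e \<in> FG"
    then obtain a b where "b \<in> B" "ends G e = {a, b}" using edge_G[OF subsetD[OF FG_sub e]] by metis
    then show "e \<in> eF ` B" using eF(3)[of b e] e by auto
  qed
  then have "card FG \<le> card B" using AB(3) surj_card_le by blast
  moreover have "card (\<Union>v\<in>B. NF v) \<le> (\<Sum>v\<in>B. t v)"
    using card_UN_le[OF AB(3), of NF] sum_mono[of B "\<lambda>v. card (NF v)" t] NF(3) by (meson order_trans)
  moreover have "(\<Sum>v\<in>B. t v + 1) = (\<Sum>v\<in>B. t v) + card B" by (simp only: sum.distrib card_eq_sum)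
  ultimately show ?thesis unfolding FK_def using card_Un_le[of FG "\<Union>v\<in>B. NF v"] by linarith
qed

lemma tau_K: "KK.tau (terms K) = (\<Sum>v\<in>B. t v + 1)" "card FK = KK.tau (terms K)" if ne: "A \<noteq> {}"
proof -
  obtain a where a: "a \<in> A" using ne by auto
  have "(\<Sum>v\<in>B. t v + 1) \<le> card J" if "KK.joins (terms K) J" for J
    using lower_bound[of a a J] that a by (simp add: sdiff_ac)
  moreover obtain J where "KK.joins (terms K) J" "card J = KK.tau (terms K)"
    using KK.tau_attained FK_join KK.feasible_def by metis
  ultimately show "KK.tau (terms K) = (\<Sum>v\<in>B. t v + 1)" "card FK = KK.tau (terms K)"
    using KK.tau_le[OF FK_join] card_FK by (metis le_antisym order_trans)+
qed

lemma B_empty: "A = {} \<Longrightarrow> B = {}"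
proof (rule ccontr)
  assume "A = {}" "B \<noteq> {}"
  then obtain v where "v \<in> B" by auto
  then have "eF v \<in> edges G" using eF(1) FG_sub by auto
  then show False using edge_G \<open>A = {}\<close> by (metis empty_iff)
qed

lemma extreme_A: "extreme K A"
  unfolding KK.extreme_iff
proof (intro conjI ballI allI impI)
  show "KK.feasible (terms K)" using FK_join by (auto simp: KK.feasible_def)
  show "A \<subseteq> verts K" using verts_K by auto
  fix x y J assume "x \<in> A" "y \<in> A" "KK.joins (terms K \<oplus> {x} \<oplus> {y}) J"
  then show "KK.tau (terms K) \<le> card J" using lower_bound tau_K(1) by (metis empty_iff)
qed

lemma has_join_K: "has_join K" using extreme_A by (simp add: extreme_def)

lemma negative_distance:
  assumes "y \<in> verts K - A"
  shows "\<exists>a\<in>A. \<exists>J. KK.joins (terms K \<oplus> {a} \<oplus> {y}) J \<and> card J < KK.tau (terms K)"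
proof -
  obtain v where v: "v \<in> B" "y \<in> V v" using assms verts_K by auto
  then have "A \<noteq> {}" using B_empty by auto
  note tau = tau_K[OF this]
  obtain a where a: "a \<in> A" "ends K (eF v) = {a, zF v}" "zF v \<in> V v" using zF[OF v(1)] .
  obtain N where N: "N \<subseteq> edges (H v)" "boundary (ends K) N = (terms K \<inter> V v) \<oplus> {y}" "card N \<le> t v"
    using tooth_join[OF v] .
  have e: "eF v \<in> edges K" using eF(1)[OF v(1)] FG_sub edges_G by auto
  have NK: "N \<subseteq> edges K" "NF v \<subseteq> edges K" using N(1) NF(1)[OF v(1)] tooth_subgraph(2)[OF v(1)] by auto
  have e1: "KK.joins ({a} \<oplus> {zF v}) {eF v}" using KK.en_sdiff[OF e a(2)] e by (simp add: KK.joins_def)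
  have N1: "KK.joins ((terms K \<inter> V v) \<oplus> {zF v}) (NF v)" "KK.joins ((terms K \<inter> V v) \<oplus> {y}) N"
    using NF(2)[OF v(1)] N(2) NK by (auto simp: KK.joins_def)
  define J where "J = FK \<oplus> {eF v} \<oplus> NF v \<oplus> N"
  have J: "KK.joins (terms K \<oplus> {a} \<oplus> {y}) J"
    using KK.joins_sdiff[OF KK.joins_sdiff[OF KK.joins_sdiff[OF FK_join e1] N1(1)] N1(2)]
    by (simp add: J_def sdiff_ac)
  have "insert (eF v) (NF v) \<subseteq> FK" using eF(1)[OF v(1)] v(1) by (auto simp: FK_def)
  then have *: "FK \<oplus> {eF v} \<oplus> NF v = FK - insert (eF v) (NF v)" using eF_NF[OF v(1)] by auto
  have fin: "finite FK" "finite N" "finite (NF v)" using FK_sub NK finite_subset[OF _ KK.finE] by auto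
  define c where "c = card (NF v)"
  have "t v \<le> c"
  proof -
    have zf: "zF v \<in> Z v"
    proof -
      obtain a' b z where ab: "a' \<in> A" "b \<in> B" "z \<in> Z b" "z \<in> V b" "ends K (eF v) = {a', z}"
        using edge_G[OF subsetD[OF FG_sub eF(1)[OF v(1)]]] by metis
      then have "zF v = z" using a tooth_graft(3)[OF v(1)] tooth_graft(3)[OF ab(2)] by (metis Un_iff disjoint_iff doubleton_eq_iff)
      then show ?thesis using ab a V_disjoint v by blast
    qed
    have "multigraph.joins (edges (H v)) (ends (H v)) (terms (H v) \<oplus> {r v} \<oplus> {zF v}) (NF v)"
      using NF[OF v(1)] tooth_subgraph(4)[OF v(1)] unfolding joins_H[OF v(1)] by simp
    then show ?thesis using tooth_facts(2)[OF tooth_graft(1)[OF v(1)] tooth_graft(2)[OF v(1)], of "{zF v}"] zf unfolding t_def c_def by simp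
  qed
  have "card (FK - insert (eF v) (NF v)) + card (insert (eF v) (NF v)) = card FK"
    using \<open>insert (eF v) (NF v) \<subseteq> FK\<close> fin by (metis card_Diff_subset card_mono finite_subset le_add_diff_inverse2)
  then have "card (FK - insert (eF v) (NF v)) + c + 1 = card FK" using eF_NF[OF v(1)] fin by (simp add: c_def)
  moreover have "card J \<le> card (FK - insert (eF v) (NF v)) + card N"
    unfolding J_def * using fin by (intro card_sdiff_le) auto
  ultimately have "card J < KK.tau (terms K)" using N(3) \<open>t v \<le> c\<close> tau(2) by linarith
  then show ?thesis using a(1) J by blast
qed

lemma fringe_empty: "fringe K A = {}"
  unfolding fringe_def using KK.neg_set_iff[OF has_join_K, of A] negative_distance verts_K by blast

lemma maximal_A: "maximal_bipartitic_extreme K A"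
proof -
  have "A \<subseteq> colA K \<or> A \<subseteq> colB K"
  proof -
    have "{colA K, colB K} = {A \<union> (\<Union>v\<in>B. colB (H v)), \<Union>v\<in>B. colA (H v)}"
      using syn by (simp add: synthesis_def)
    then show ?thesis unfolding doubleton_eq_iff by auto
  qed
  moreover have "\<not> (A \<subset> Y \<and> bipartitic K Y \<and> extreme K Y)" for Y
  proof
    assume Y: "A \<subset> Y \<and> bipartitic K Y \<and> extreme K Y"
    then obtain y where y: "y \<in> Y" "y \<notin> A" by auto
    then have "y \<in> verts K - A" using Y by (auto simp: extreme_def)
    then obtain a J where "a \<in> A" "KK.joins (terms K \<oplus> {a} \<oplus> {y}) J" "card J < KK.tau (terms K)"
      using negative_distance by blast
    moreover have "a \<in> Y" using \<open>a \<in> A\<close> Y by auto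
    moreover have "extreme K Y" using Y by simp
    ultimately have "KK.tau (terms K) \<le> card J" using y(1) unfolding KK.extreme_iff by blast
    then show False using \<open>card J < KK.tau (terms K)\<close> by simp
  qed
  ultimately show ?thesis unfolding maximal_bipartitic_extreme_def bipartitic_def using extreme_A by blast
qed

end

section \<open>Decomposition along a maximal bipartitic extreme set\<close>

lemma comb_of_perfect_join:
  assumes G: "bipartite_graft G" and F: "is_join G F" and F1: "\<And>b. b \<in> colB G \<Longrightarrow> card {e \<in> F. b \<in> ends G e} = 1"
  shows "comb G"
proof -
  interpret graft_join G using bipartite_graft_join[OF G] .
  have fB: "finite (colB G)" "colB G \<subseteq> verts G"
    using G by (auto simp: bipartite_graft_def is_graft_def fin_mgraph_def intro: finite_subset)
  have cardJ: "card J = (\<Sum>b\<in>colB G. card {e \<in> J. b \<in> ends G e})" if J: "J \<subseteq> edges G" for J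
  proof -
    have e: "\<exists>a b. a \<in> colA G \<and> b \<in> colB G \<and> ends G e = {a, b}" if "e \<in> J" for e
      using G J that unfolding bipartite_graft_def by blast
    have dis: "colA G \<inter> colB G = {}" using G by (simp add: bipartite_graft_def)
    have "J = (\<Union>b\<in>colB G. {e \<in> J. b \<in> ends G e})" using e by fastforce
    then have "card J = card (\<Union>b\<in>colB G. {e \<in> J. b \<in> ends G e})" by simp
    also have "\<dots> = (\<Sum>b\<in>colB G. card {e \<in> J. b \<in> ends G e})"
    proof (rule card_UN_disjoint)
      show "\<forall>b\<in>colB G. \<forall>b'\<in>colB G. b \<noteq> b' \<longrightarrow> {e \<in> J. b \<in> ends G e} \<inter> {e \<in> J. b' \<in> ends G e} = {}"
        using e dis by fastforce
    qed (use fB finite_subset[OF J finE] in auto)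
    finally show ?thesis .
  qed
  have FE: "F \<subseteq> edges G" using F by (simp add: is_join_def)
  have cardF: "card F = card (colB G)" using cardJ[OF FE] F1 by simp
  have "card (cut G {b} \<inter> F') = 1" if F': "minimum_join G F'" and b: "b \<in> colB G" for F' b
  proof -
    have F'E: "F' \<subseteq> edges G" and j': "is_join G F'" and le: "card F' \<le> card F"
      using F' F by (auto simp: minimum_join_def is_join_def)
    have ge1: "1 \<le> card {e \<in> F'. b \<in> ends G e}" if "b \<in> colB G" for b
    proof -
      have bv: "b \<in> verts G" using fB that by auto
      have "b \<in> terms G" using F F1[OF that] bv by (auto simp: is_join_def)
      then have "odd (card {e \<in> F'. b \<in> ends G e})" using j' bv by (auto simp: is_join_def)
      then show ?thesis using odd_pos by fastforce
    qed
    have "card {e \<in> F'. b \<in> ends G e} = 1"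
    proof (rule ccontr)
      assume "card {e \<in> F'. b \<in> ends G e} \<noteq> 1"
      then have "1 < card {e \<in> F'. b \<in> ends G e}" using ge1[OF b] by simp
      then have "(\<Sum>b\<in>colB G. 1) < (\<Sum>b\<in>colB G. card {e \<in> F'. b \<in> ends G e})"
        using fB b ge1 by (intro sum_strict_mono_ex1) auto
      then show False using cardJ[OF F'E] le cardF by simp
    qed
    moreover have "cut G {b} \<inter> F' = {e \<in> F'. b \<in> ends G e}"
    proof -
      have "card (ends G e \<inter> {b}) = 1 \<longleftrightarrow> b \<in> ends G e" for e by (cases "b \<in> ends G e") auto
      then show ?thesis using F'E by (auto simp: cut_def)
    qed
    ultimately show ?thesis by simp
  qed
  then show ?thesis using G F by (auto simp: comb_def has_join_def)
qed

locale maximal_extreme =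
  fixes K :: "('v, 'e) bgraft" and X P Q :: "'v set" and x0 :: 'v
  assumes K: "bipartite_graft K" and PQ: "P = colA K \<and> Q = colB K \<or> P = colB K \<and> Q = colA K"
    and max: "maximal_bipartitic_extreme K X" and XP: "X \<subseteq> P" and x0: "x0 \<in> X"
begin

sublocale KK: graft_join K using bipartite_graft_join[OF K] .

lemma edge_PQ: assumes "e \<in> edges K" obtains p q where "p \<in> P" "q \<in> Q" "ends K e = {p, q}"
  using K PQ assms unfolding bipartite_graft_def by (metis insert_commute)

lemma PQ_verts: "P \<union> Q = verts K" "P \<inter> Q = {}"
  using K PQ by (auto simp: bipartite_graft_def)

lemma extreme_X: "extreme K X" using max by (simp add: maximal_bipartitic_extreme_def)

definition F :: "'e set" where "F = (SOME F. minimum_join K F)"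
abbreviation "T \<equiv> terms K"
abbreviation "tauK \<equiv> KK.tau (terms K)"
text \<open>\<open>en'\<close> are the ends after identifying \<open>X\<close> with \<open>x0\<close>. No edge becomes a loop, because \<open>X\<close> lies in one
  colour class.\<close>

definition con :: "'v \<Rightarrow> 'v" where "con v = (if v \<in> X then x0 else v)"
definition en' :: "'e \<Rightarrow> 'v set" where "en' e = con ` ends K e"
definition S :: "'v set" where "S = boundary en' F \<oplus> {x0}"

lemma F: "KK.joins T F" "card F = tauK" "F \<subseteq> edges K"
proof -
  have "has_join K" using extreme_X by (simp add: extreme_def)
  then have "minimum_join K F" unfolding F_def using KK.minimum_join_exists by (metis someI_ex)
  then show "KK.joins T F" "card F = tauK" "F \<subseteq> edges K" by (auto simp: KK.minimum_join_iff KK.joins_def)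
qed

lemma edge_con:
  assumes "e \<in> edges K"
  obtains p q where "p \<in> P" "q \<in> Q" "ends K e = {p, q}" "en' e = {con p, q}" "con p \<in> P" "q \<notin> X" "p \<noteq> q" "con p \<noteq> q"
proof -
  obtain p q where pq: "p \<in> P" "q \<in> Q" "ends K e = {p, q}" using edge_PQ[OF assms] .
  moreover have "q \<notin> X" using pq XP PQ_verts by auto
  moreover have "con p \<in> P" using pq XP x0 by (auto simp: con_def)
  moreover have "en' e = {con p, q}" using pq \<open>q \<notin> X\<close> by (auto simp: en'_def con_def)
  ultimately show ?thesis using that PQ_verts by blast
qed

sublocale L: levels "edges K" en' P S
proof
  show "finite (edges K)" using KK.finE .
  fix e assume e: "e \<in> edges K"
  obtain p q where pq: "p \<in> P" "q \<in> Q" "en' e = {con p, q}" "con p \<in> P" "con p \<noteq> q"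
    using edge_con[OF e] by metis
  then show "card (en' e) = 2" by simp
  have "en' e \<inter> P = {con p}" using pq PQ_verts by auto
  then show "card (en' e \<inter> P) = 1" by simp
qed

lemma en'_iff: "v \<notin> X \<Longrightarrow> v \<in> en' e \<longleftrightarrow> v \<in> ends K e"
  using x0 by (auto simp: en'_def con_def image_iff)

lemma en'_X: "v \<in> X \<Longrightarrow> v \<noteq> x0 \<Longrightarrow> v \<notin> en' e"
  by (auto simp: en'_def con_def split: if_splits)

lemma en'_eq: "ends K e \<inter> X = {} \<Longrightarrow> en' e = ends K e"
  by (force simp: en'_def con_def image_iff)

lemma boundary'_iff: "v \<notin> X \<Longrightarrow> v \<in> boundary en' J \<longleftrightarrow> v \<in> boundary (ends K) J"
  by (simp add: boundary_def en'_iff)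

lemma boundary'_X: "v \<in> X \<Longrightarrow> v \<noteq> x0 \<Longrightarrow> v \<notin> boundary en' J"
  using boundary_subset[of en' J] en'_X by blast

lemma S_iff: "v \<notin> X \<Longrightarrow> v \<in> S \<longleftrightarrow> v \<in> T"
  using boundary'_iff[of v F] F x0 by (auto simp: S_def KK.joins_def)

lemma Sx0: "S \<oplus> {x0} = boundary en' F" by (simp add: S_def sdiff_ac)

lemma joins_x0: "L.joins (S \<oplus> {x0}) F" using F by (simp add: L.joins_def Sx0)

lemma boundary'_pair:
  assumes "M \<subseteq> edges K" "boundary (ends K) M - X = {y}" "y \<notin> X"
  shows "boundary en' M = {x0} \<oplus> {y}"
proof -
  have 1: "v \<in> boundary en' M \<longleftrightarrow> v = y" if "v \<noteq> x0" for v
    using boundary'_iff[of v M] boundary'_X[of v M] assms that by (cases "v \<in> X") auto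
  have yx: "y \<noteq> x0" using assms x0 by auto
  have x0M: "x0 \<in> boundary en' M"
  proof (rule ccontr)
    assume "x0 \<notin> boundary en' M"
    then have "boundary en' M = {y}" using 1 yx by (metis insertI1 singletonD subsetI subset_antisym)
    then show False using L.even_boundary[OF assms(1)] by simp
  qed
  show ?thesis
  proof (rule set_eqI)
    fix v show "v \<in> boundary en' M \<longleftrightarrow> v \<in> {x0} \<oplus> {y}"
      using x0M 1[of v] yx by (cases "v = x0") simp_all
  qed
qed

lemma joins_contract:
  assumes J: "KK.joins (T \<oplus> {x} \<oplus> {y}) J" and x: "x \<in> X" and y: "y \<notin> X"
  shows "L.joins (S \<oplus> {y}) J"
proof -
  have M: "F \<oplus> J \<subseteq> edges K" "boundary (ends K) (F \<oplus> J) = {x} \<oplus> {y}"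
    using KK.joins_sdiff[OF F(1) J] by (auto simp: KK.joins_def sdiff_ac)
  then have "boundary en' (F \<oplus> J) = {x0} \<oplus> {y}" using x y by (intro boundary'_pair) auto
  then have "L.joins ({x0} \<oplus> {y}) (F \<oplus> J)" using M by (simp add: L.joins_def)
  from L.joins_sdiff[OF joins_x0 this] show ?thesis by (simp add: sdiff_ac)
qed

lemma extreme_even: "finite U \<Longrightarrow> U \<subseteq> X \<Longrightarrow> even (card U) \<Longrightarrow> KK.joins (T \<oplus> U) J \<Longrightarrow> tauK \<le> card J"
proof (rule KK.extreme_even_set[OF F(1,2)])
  show "tauK \<le> card J" if "KK.joins T J" for J using KK.tau_le[OF that] .
  show "tauK \<le> card J" if "p \<in> X" "q \<in> X" "KK.joins (T \<oplus> ({p} \<oplus> {q})) J" for p q J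
    using extreme_X that unfolding KK.extreme_iff by (simp add: sdiff_assoc)
qed

lemma joins_lift:
  assumes J: "L.joins (S \<oplus> {y}) J" and y: "y \<notin> X"
  obtains x J' where "x \<in> X" "KK.joins (T \<oplus> {x} \<oplus> {y}) J'" "card J' \<le> card J"
proof -
  have JK: "J \<subseteq> edges K" using J by (simp add: L.joins_def)
  define W where "W = boundary (ends K) (F \<oplus> J)"
  have M: "KK.joins W (F \<oplus> J)" using JK F by (auto simp: KK.joins_def W_def)
  have J1: "KK.joins (T \<oplus> W) J" using KK.joins_sdiff[OF F(1) M] by (simp add: sdiff_ac)
  have "(S \<oplus> {x0}) \<oplus> (S \<oplus> {y}) = {x0} \<oplus> {y}" by (simp add: sdiff_ac)
  then have "boundary en' (F \<oplus> J) = {x0} \<oplus> {y}" using L.joins_sdiff[OF joins_x0 J] by (simp add: L.joins_def)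
  then have W: "v \<in> W \<longleftrightarrow> v = y" if "v \<notin> X" for v
    using boundary'_iff[OF that, of "F \<oplus> J"] x0 that by (auto simp: W_def)
  have "(T \<oplus> W) \<oplus> T = W" by (simp add: sdiff_ac)
  then obtain x K1 K2 where x: "x \<in> W" "x \<noteq> y" "KK.joins ((T \<oplus> W) \<oplus> ({y} \<oplus> {x})) K1"
    "KK.joins (T \<oplus> ({y} \<oplus> {x})) K2" "card K1 + card K2 = card J + card F"
    using KK.exchange[OF J1 F(1), of y] W y by metis
  have xX: "x \<in> X" using x W by blast
  have "W \<oplus> ({y} \<oplus> {x}) = W - {x, y}" using x W[OF y] by auto
  then have K1: "KK.joins (T \<oplus> (W - {x, y})) K1" using x(3) by (simp add: sdiff_assoc)
  have fW: "finite W" using KK.finite_boundary M by (metis KK.joins_def)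
  have "even (card W)" using KK.even_boundary M by (metis KK.joins_def)
  moreover have "card W = card (W - {x, y}) + 2"
    using x W[OF y] fW card_Diff_subset[of "{x, y}" W] card_mono[of W "{x, y}"] by simp
  ultimately have "tauK \<le> card K1" using extreme_even[OF _ _ _ K1] fW W by auto
  then have "card K2 \<le> card J" using x(5) F(2) by simp
  moreover have "KK.joins (T \<oplus> {x} \<oplus> {y}) K2" using x(4) by (simp add: sdiff_ac)
  ultimately show ?thesis using that xX by blast
qed

lemma level_x0: "L.has_level x0" "L.level x0 = tauK"
proof -
  show "L.has_level x0" using joins_x0 by (auto simp: L.has_level_def L.feasible_def)
  then obtain J where J: "L.joins (S \<oplus> {x0}) J" "card J = L.level x0" using L.level_attained by blast
  have JK: "J \<subseteq> edges K" using J by (simp add: L.joins_def)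
  define W where "W = boundary (ends K) (F \<oplus> J)"
  have M: "KK.joins W (F \<oplus> J)" using JK F by (auto simp: KK.joins_def W_def)
  have "boundary en' (F \<oplus> J) = {}" using L.joins_sdiff[OF joins_x0 J(1)] by (simp add: L.joins_def sdiff_ac)
  then have "W \<subseteq> X" using boundary'_iff[of _ "F \<oplus> J"] by (auto simp: W_def)
  moreover have "KK.joins (T \<oplus> W) J" using KK.joins_sdiff[OF F(1) M] by (simp add: sdiff_ac)
  moreover have "finite W" "even (card W)" using KK.finite_boundary KK.even_boundary M by (metis KK.joins_def)+
  ultimately have "tauK \<le> card J" using extreme_even by blast
  then show "L.level x0 = tauK" using L.level_le[OF joins_x0] J F(2) by simp
qed

abbreviation "N \<equiv> neg_set K X"

lemma has_level_cases: "L.has_level y \<Longrightarrow> y = x0 \<or> y \<in> verts K - X"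
proof (rule ccontr)
  assume has_level: "L.has_level y" and n: "\<not> (y = x0 \<or> y \<in> verts K - X)"
  obtain J where J: "L.joins (S \<oplus> {y}) J" using L.level_attained[OF has_level] .
  have "y \<notin> boundary en' J'" if "J' \<subseteq> edges K" for J'
  proof (cases "y \<in> X")
    case True
    then show ?thesis using n boundary'_X by blast
  next
    case False
    then have "y \<notin> verts K" using n by blast
    then show ?thesis using boundary'_iff[OF False, of J'] boundary_subset[of "ends K" J'] KK.ends_verts that by blast
  qed
  from this[of J] this[of F] have "y \<notin> S \<oplus> {y}" "y \<notin> boundary en' F" using J F(3) by (simp_all only: L.joins_def) auto
  then show False using n by (auto simp: S_def)
qed

lemma N_iff: "y \<in> N \<longleftrightarrow> L.has_level y \<and> L.level y < tauK"
proof -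
  have hj: "has_join K" "X \<subseteq> verts K" using extreme_X by (auto simp: extreme_def)
  show ?thesis
  proof
    assume "y \<in> N"
    then obtain x J where J: "y \<in> verts K - X" "x \<in> X" "KK.joins (T \<oplus> {x} \<oplus> {y}) J" "card J < tauK"
      using KK.neg_set_iff[OF hj] by blast
    then have "L.joins (S \<oplus> {y}) J" using joins_contract by blast
    then show "L.has_level y \<and> L.level y < tauK" using L.level_le J(4) by (auto simp: L.has_level_def L.feasible_def intro: le_less_trans)
  next
    assume y: "L.has_level y \<and> L.level y < tauK"
    then have yX: "y \<in> verts K - X" using has_level_cases level_x0 by fastforce
    obtain J where J: "L.joins (S \<oplus> {y}) J" "card J = L.level y" using L.level_attained y by blast
    obtain x J' where "x \<in> X" "KK.joins (T \<oplus> {x} \<oplus> {y}) J'" "card J' \<le> card J" using joins_lift[OF J(1)] yX by blast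
    then show "y \<in> N" using KK.neg_set_iff[OF hj] yX J y by fastforce
  qed
qed

lemma N_X: "y \<in> N \<Longrightarrow> y \<notin> X" "y \<in> N \<Longrightarrow> y \<in> verts K"
  by (auto simp: neg_set_def)

lemma edge_leaving_N:
  assumes e: "e \<in> edges K" "ends K e = {z, y}" and z: "z \<in> N" and y: "y \<notin> N"
  shows "y \<in> X"
proof (rule ccontr)
  assume yX: "y \<notin> X"
  have en: "en' e = {z, y}" using en'_eq[of e] e N_X(1)[OF z] yX by simp
  have fez: "L.has_level z" "L.level z < tauK" using z N_iff by auto
  have fey: "L.has_level y" using L.edge_step(1) fez e(1) en by blast
  then have hy: "L.level y = tauK" using L.edge_step(2)[OF fez(1) e(1) en] fez(2) y N_iff by fastforce
  obtain J where J: "L.joins (S \<oplus> {y}) J" "card J = tauK" using L.level_attained[OF fey] hy by metis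
  have yP: "y \<in> P"
  proof (rule ccontr)
    assume "y \<notin> P"
    then have 1: "(S \<oplus> {y}) \<inter> P = S \<inter> P" by auto
    have 2: "(S \<oplus> {x0}) \<inter> P = (S \<inter> P) \<oplus> {x0}" using x0 XP by auto
    have "finite (boundary en' F)" using L.finite_boundary F by blast
    then have fin: "finite (S \<inter> P)" by (simp add: S_def)
    show False using L.parity_class[OF J(1)] L.parity_class[OF joins_x0] J(2) F(2) odd_card_sdiff[OF fin, of "{x0}"]
      unfolding 1 2 by simp
  qed
  have yV: "y \<in> verts K" using KK.ends_verts e by blast
  have J1: "tauK \<le> card J" if "KK.joins (T \<oplus> {x} \<oplus> {y}) J" "x \<in> X" for x J
    using L.level_le[OF joins_contract[OF that(1,2) yX]] hy by simp
  have "extreme K (insert y X)"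
    unfolding KK.extreme_iff
  proof (intro conjI ballI allI impI)
    show "KK.feasible T" using F by (auto simp: KK.feasible_def)
    show "insert y X \<subseteq> verts K" using extreme_X yV by (auto simp: extreme_def)
    fix u v J assume u: "u \<in> insert y X" "v \<in> insert y X" and J: "KK.joins (T \<oplus> {u} \<oplus> {v}) J"
    consider "u \<in> X" "v \<in> X" | "u \<in> X" "v = y" | "v \<in> X" "u = y" | "u = y" "v = y" using u by auto
    then show "tauK \<le> card J"
    proof cases
      case 1
      then show ?thesis using J extreme_X unfolding KK.extreme_iff by blast
    next
      case 2
      then show ?thesis using J1 J by blast
    next
      case 3
      then show ?thesis using J1[of v J] J by (simp add: sdiff_ac)
    next
      case 4
      then show ?thesis using J KK.tau_le[of T J] by (simp add: sdiff_ac)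
    qed
  qed
  moreover have "bipartitic K (insert y X)" using XP yP PQ by (auto simp: bipartitic_def)
  moreover have "X \<subset> insert y X" using yX by auto
  ultimately show False using max unfolding maximal_bipartitic_extreme_def by blast
qed

definition j :: nat where "j = tauK - 1"
definition D :: "'v \<Rightarrow> 'v set" where "D u = Collect (L.conn j u)"
definition I :: "'v set" where "I = {s. \<exists>x\<in>X. \<exists>e\<in>F. ends K e = {s, x}}"

lemma le_j: "y \<in> N \<Longrightarrow> L.level y \<le> j" "y \<in> N \<Longrightarrow> tauK = j + 1"
  using N_iff by (auto simp: j_def)

lemma D_N: "u \<in> N \<Longrightarrow> w \<in> D u \<Longrightarrow> w \<in> N"
  using L.connD[of j u w] le_j(2)[of u] N_iff[of w] by (auto simp: D_def)

lemma D_self: "u \<in> N \<Longrightarrow> u \<in> D u"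
  using L.conn_refl N_iff le_j by (auto simp: D_def)

lemma D_eq: "w \<in> D u \<Longrightarrow> D w = D u"
  using L.conn_sym L.conn_trans unfolding D_def by blast

lemma D_edge: "u \<in> N \<Longrightarrow> e \<in> edges K \<Longrightarrow> ends K e = {z, y} \<Longrightarrow> z \<in> D u \<Longrightarrow> y \<in> N \<Longrightarrow> y \<in> D u"
proof -
  assume *: "u \<in> N" "e \<in> edges K" "ends K e = {z, y}" "z \<in> D u" "y \<in> N"
  then have "ends K e \<inter> X = {}" using D_N N_X by auto
  then have "en' e = {z, y}" using en'_eq *(3) by simp
  then show ?thesis using L.conn_step[of j u z e y] * le_j(1) by (auto simp: D_def)
qed

lemma D_crossing: "u \<in> N \<Longrightarrow> L.crossing J (D u) = KK.crossing J (D u)"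
proof -
  assume u: "u \<in> N"
  have "en' e \<inter> D u = ends K e \<inter> D u" for e using en'_iff D_N[OF u] N_X by blast
  then show ?thesis by (simp add: L.crossing_def KK.crossing_def)
qed

lemma D_inside: "u \<in> N \<Longrightarrow> J \<subseteq> edges K \<Longrightarrow> e \<in> J \<Longrightarrow> en' e \<subseteq> D u \<longleftrightarrow> ends K e \<subseteq> D u"
proof -
  assume u: "u \<in> N"
  have "con v \<in> D u \<longleftrightarrow> v \<in> D u" for v using D_N[OF u] N_X x0 by (auto simp: con_def)
  then show ?thesis by (auto simp: en'_def)
qed

lemma edge_D:
  assumes e: "e \<in> edges K" "ends K e = {z, y}" and u: "u \<in> N" "z \<in> D u" "y \<notin> D u"
  shows "y \<in> X" "L.level z = j"
proof -
  have z: "z \<in> N" using D_N u by blast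
  have "y \<notin> N" using D_edge u e by blast
  then show y: "y \<in> X" using edge_leaving_N e z by blast
  have "en' e = {z, x0}" using e(2) y N_X(1)[OF z] by (simp add: en'_def con_def)
  then show "L.level z = j" using L.edge_levels[of z e x0] e z N_iff level_x0 le_j by fastforce
qed

lemma crossing_edge:
  assumes e: "e \<in> KK.crossing J (D u)" "J \<subseteq> edges K" and u: "u \<in> N"
  obtains x z where "x \<in> X" "z \<in> D u" "ends K e = {z, x}" "L.level z = j" "e \<in> J"
proof -
  have e': "e \<in> J" "e \<in> edges K" "card (ends K e \<inter> D u) = 1" using e by (auto simp: KK.crossing_def)
  obtain a b where ab: "ends K e = {a, b}" "a \<noteq> b" using KK.en_cases e'(2) by blast
  then consider "a \<in> D u" "b \<notin> D u" | "b \<in> D u" "a \<notin> D u"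
    using e'(3) by (cases "a \<in> D u"; cases "b \<in> D u") auto
  then show ?thesis
  proof cases
    case 1
    then show ?thesis using that[of b a] edge_D[OF e'(2) ab(1) u] ab e' by auto
  next
    case 2
    then show ?thesis using that[of a b] edge_D[OF e'(2), of b a u] u ab e' by (auto simp: insert_commute)
  qed
qed

lemma I_N: "s \<in> I \<Longrightarrow> s \<in> N \<and> L.level s = j"
proof -
  assume "s \<in> I"
  then obtain x e where e: "x \<in> X" "e \<in> F" "ends K e = {s, x}" by (auto simp: I_def)
  have eK: "e \<in> edges K" using e F by auto
  obtain p q where pq: "p \<in> P" "ends K e = {p, q}" "q \<notin> X" "p \<noteq> q" using edge_con[OF eK] by metis
  have sX: "s \<notin> X" using e pq by (metis doubleton_eq_iff)
  then have en: "en' e = {s, x0}" using e by (simp add: en'_def con_def)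
  have 1: "L.joins (S \<oplus> {s}) (F - {e})" using L.joins_remove(1)[OF joins_x0 e(2) en] by (simp add: sdiff_ac)
  then have "L.has_level s" by (auto simp: L.has_level_def L.feasible_def)
  moreover have "L.level s < tauK" using L.level_le[OF 1] L.joins_remove(2)[OF joins_x0 e(2) en] F(2) by simp
  ultimately have "s \<in> N" using N_iff by blast
  moreover have "L.level s = j" using L.edge_levels[OF \<open>L.has_level s\<close> eK en] level_x0 \<open>L.level s < tauK\<close> by (auto simp: j_def)
  ultimately show ?thesis by blast
qed

lemma crossing_F: "u \<in> N \<Longrightarrow> card (KK.crossing F (D u)) = 1"
proof -
  assume u: "u \<in> N"
  have x0': "\<not> L.conn j u x0" using D_N[OF u, of x0] N_X x0 by (auto simp: D_def)
  obtain s where s: "L.conn j u s" "L.level s = j"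
    using L.conn_level[of u j x0] x0' level_x0 N_iff[of u] le_j[OF u] u by metis
  have "card F = L.level x0" using F level_x0 by simp
  from L.crossing_card[OF joins_x0 this s] show ?thesis using x0' D_crossing[OF u, of F] by (simp add: D_def)
qed

lemma D_I: assumes "u \<in> N" obtains s where "s \<in> I" "s \<in> D u"
proof -
  obtain e where "e \<in> KK.crossing F (D u)" using crossing_F[OF assms] by (metis card.empty equals0I zero_neq_one)
  then obtain x z where "x \<in> X" "z \<in> D u" "ends K e = {z, x}" "e \<in> F" using crossing_edge assms F(3) by metis
  then show ?thesis using that by (auto simp: I_def)
qed

lemma I_crossing:
  assumes "s \<in> I" obtains x e where "x \<in> X" "e \<in> F" "ends K e = {s, x}" "KK.crossing F (D s) = {e}"
proof -
  obtain x e where e: "x \<in> X" "e \<in> F" "ends K e = {s, x}" using assms by (auto simp: I_def)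
  have s: "s \<in> N" using I_N assms by blast
  have "x \<notin> D s" using e D_N[OF s] N_X by blast
  then have "ends K e \<inter> D s = {s}" using e D_self[OF s] by auto
  then have "e \<in> KK.crossing F (D s)" using e by (simp add: KK.crossing_def)
  moreover obtain e' where "KK.crossing F (D s) = {e'}" using crossing_F[OF s] card_1_singletonE by blast
  ultimately show ?thesis using that[OF e] by auto
qed

lemma I_unique: "s \<in> I \<Longrightarrow> s' \<in> I \<Longrightarrow> w \<in> D s \<Longrightarrow> w \<in> D s' \<Longrightarrow> s = s'"
proof -
  assume s: "s \<in> I" "s' \<in> I" "w \<in> D s" "w \<in> D s'"
  obtain x e where e: "x \<in> X" "ends K e = {s, x}" "KK.crossing F (D s) = {e}" using I_crossing[OF s(1)] by metis
  obtain x' e' where e': "x' \<in> X" "ends K e' = {s', x'}" "KK.crossing F (D s') = {e'}" using I_crossing[OF s(2)] by metis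
  have "D s = D s'" using D_eq s by metis
  then have "e = e'" using e e' by auto
  moreover have "s \<notin> X" "s' \<notin> X" using s I_N N_X by blast+
  ultimately show ?thesis using e e' by (metis doubleton_eq_iff)
qed

lemma finite_I: "finite I"
proof -
  have "I \<subseteq> verts K" using I_N N_X by blast
  then show ?thesis using KK.graft finite_subset by (auto simp: is_graft_def fin_mgraph_def)
qed

definition tooth :: "'v \<Rightarrow> ('v, 'e) bgraft" where
  "tooth s = \<lparr>verts = D s, edges = {e \<in> edges K. ends K e \<subseteq> D s}, ends = ends K,
     terms = (T \<inter> D s) \<oplus> {s}, colA = D s \<inter> Q, colB = D s \<inter> P\<rparr>"

lemma tooth_sel [simp]: "verts (tooth s) = D s" "edges (tooth s) = {e \<in> edges K. ends K e \<subseteq> D s}"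
  "ends (tooth s) = ends K" "terms (tooth s) = (T \<inter> D s) \<oplus> {s}" "colA (tooth s) = D s \<inter> Q" "colB (tooth s) = D s \<inter> P"
  by (auto simp: tooth_def)

lemma tooth_bipartite: "s \<in> I \<Longrightarrow> bipartite_graft (tooth s)"
proof -
  assume "s \<in> I"
  then have s: "s \<in> N" using I_N by blast
  have DV: "D s \<subseteq> verts K" using D_N[OF s] N_X by blast
  have "\<exists>a\<in>D s \<inter> Q. \<exists>b\<in>D s \<inter> P. ends K e = {a, b}" if e: "e \<in> edges K" "ends K e \<subseteq> D s" for e
  proof -
    obtain p q where "p \<in> P" "q \<in> Q" "ends K e = {p, q}" using edge_PQ e by metis
    then show ?thesis using e(2) by (intro bexI[of _ q] bexI[of _ p]) auto
  qed
  moreover have "finite (D s)" using DV KK.graft finite_subset by (auto simp: is_graft_def fin_mgraph_def)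
  ultimately show ?thesis
    using DV PQ_verts KK.finE KK.card2 D_self[OF s]
    by (auto simp: bipartite_graft_def is_graft_def fin_mgraph_def)
qed

lemma I_Q: "s \<in> I \<Longrightarrow> s \<in> Q"
proof -
  assume s: "s \<in> I"
  obtain x e where e: "x \<in> X" "e \<in> F" "ends K e = {s, x}" using I_crossing[OF s] by metis
  obtain p q where "p \<in> P" "q \<in> Q" "ends K e = {p, q}" using edge_PQ e F by blast
  then show ?thesis using e XP PQ_verts I_N[OF s] by (metis disjoint_iff doubleton_eq_iff subsetD)
qed

lemma tooth_primal_zero:
  assumes sI: "s \<in> I"
  shows "primal (tooth s) s" and "\<And>w. w \<in> D s \<Longrightarrow> L.level w = j \<Longrightarrow> w \<in> zero_set (tooth s) s"
proof -
  interpret H: graft_join "tooth s" using bipartite_graft_join[OF tooth_bipartite[OF sI]] .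
  have s: "s \<in> N" "L.level s = j" "L.has_level s" using I_N[OF sI] N_iff by auto
  note tauK = le_j(2)[OF s(1)]
  obtain x e where e: "x \<in> X" "e \<in> F" "ends K e = {s, x}" "KK.crossing F (D s) = {e}" using I_crossing[OF sI] .
  have en: "en' e = {s, x0}" using e N_X(1)[OF s(1)] by (simp add: en'_def con_def)
  define F0 where "F0 = F - {e}"
  have F0: "L.joins (S \<oplus> {s}) F0" "card F0 = j"
    unfolding F0_def using L.joins_remove[OF joins_x0 e(2) en] F(2) tauK by (simp_all add: sdiff_ac)
  have F0c: "L.crossing F0 (D s) = {}" using e(4) D_crossing[OF s(1)] by (auto simp: F0_def KK.crossing_def)
  have F0K: "F0 \<subseteq> edges K" using F by (auto simp: F0_def)
  define M where "M = L.inside F0 (D s)"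
  define R where "R = L.inside F0 (- D s)"
  have MR: "boundary en' M = (S \<oplus> {s}) \<inter> D s" "j = card M + card R"
    using L.no_crossing[OF F0(1) F0c] F0(2) by (auto simp: M_def R_def)
  have ins: "e \<in> edges K \<and> en' e \<subseteq> D s \<longleftrightarrow> e \<in> edges (tooth s)" for e
    using D_inside[OF s(1), of "edges K" e] by auto
  have insE: "L.inside J (D s) \<subseteq> edges (tooth s)" if "J \<subseteq> edges K" for J
    using that ins by (auto simp: L.inside_def simp del: tooth_sel)
  have bdH: "boundary (ends (tooth s)) J = boundary en' J" if "J \<subseteq> edges (tooth s)" for J
  proof (rule boundary_cong)
    fix e assume "e \<in> J"
    then have "ends K e \<inter> X = {}" using that D_N[OF s(1)] N_X by fastforce
    then show "ends (tooth s) e = en' e" using en'_eq by simp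
  qed
  have SD: "(S \<oplus> {w}) \<inter> D s = (T \<inter> D s) \<oplus> {w}" if "w \<in> D s" for w
    using S_iff D_N[OF s(1)] N_X(1) that by auto
  have joinsH: "H.joins ((T \<inter> D s) \<oplus> {w}) J \<longleftrightarrow> J \<subseteq> edges (tooth s) \<and> boundary en' J = (S \<oplus> {w}) \<inter> D s" if "w \<in> D s" for w J
    unfolding H.joins_def SD[OF that] using bdH[of J] by metis
  have ss: "s \<in> D s" using D_self s by blast
  have upper: "\<exists>J. H.joins ((T \<inter> D s) \<oplus> {w}) J \<and> card J \<le> card M" if w: "w \<in> D s" for w
  proof -
    have fw: "L.has_level w" "L.level w \<le> j" using w L.connD by (auto simp: D_def)
    obtain J where J: "L.joins (S \<oplus> {w}) J" "card J = L.level w" using L.level_attained[OF fw(1)] .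
    have JK: "J \<subseteq> edges K" using J by (simp add: L.joins_def)
    have "card (L.crossing J (D s)) = 0"
      using L.crossing_card[OF J, of j s s] ss s w by (simp add: D_def)
    then have c: "L.crossing J (D s) = {}" using L.finite_crossing[OF JK] by simp
    note nc = L.no_crossing[OF J(1) c]
    have bdM: "boundary en' M \<oplus> (S \<oplus> {w} - D s) = S \<oplus> {s}" unfolding MR(1) using w ss by auto
    have MK: "M \<subseteq> edges K" "\<And>e. e \<in> M \<Longrightarrow> en' e \<subseteq> D s" using F0K by (auto simp: M_def L.inside_def)
    have "L.joins (S \<oplus> {s}) (M \<oplus> L.inside J (- D s))"
      using L.patch(1)[OF MK J(1) c] unfolding bdM .
    then have "j \<le> card M + card (L.inside J (- D s))"
      using L.patch(2)[OF MK J(1) c] L.level_le s(2) by fastforce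
    then have "card (L.inside J (D s)) \<le> card M" using nc(2) J(2) fw(2) by simp
    moreover have "H.joins ((T \<inter> D s) \<oplus> {w}) (L.inside J (D s))"
      unfolding joinsH[OF w] using nc(1) insE[OF JK] by blast
    ultimately show ?thesis by blast
  qed
  have lower: "card M \<le> card J" if J: "H.joins ((T \<inter> D s) \<oplus> {w}) J" and w: "w \<in> D s" "L.level w = j" for w J
  proof -
    have J': "J \<subseteq> edges (tooth s)" "boundary en' J = (S \<oplus> {w}) \<inter> D s" using J joinsH[OF w(1)] by auto
    have bdJ: "boundary en' J \<oplus> (S \<oplus> {s} - D s) = S \<oplus> {w}" unfolding J' using w ss by auto
    have JK: "J \<subseteq> edges K" "\<And>e. e \<in> J \<Longrightarrow> en' e \<subseteq> D s" using J'(1) ins by blast+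
    have "L.joins (S \<oplus> {w}) (J \<oplus> R)"
      using L.patch(1)[OF JK F0(1) F0c] unfolding bdJ R_def .
    then have "j \<le> card J + card R"
      using L.patch(2)[OF JK F0(1) F0c] L.level_le w(2) unfolding R_def by fastforce
    then show ?thesis using MR(2) by simp
  qed
  have T0: "terms (tooth s) \<oplus> {s} \<oplus> {w} = (T \<inter> D s) \<oplus> {w}" for w by (simp add: sdiff_ac)
  have M: "H.joins (terms (tooth s)) M"
    using joinsH[OF ss, of M] MR(1) insE[OF F0K] unfolding M_def tooth_sel(4) by blast
  then have feasible: "H.feasible (terms (tooth s))" unfolding H.feasible_def by blast
  obtain J where J: "H.joins (terms (tooth s)) J" "card J = H.tau (terms (tooth s))" using H.tau_attained[OF feasible] .
  then have tau: "H.tau (terms (tooth s)) = card M" using lower[of s J] ss s H.tau_le[OF M] by simp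
  show pr: "primal (tooth s) s"
    unfolding H.primal_iff T0 tau using feasible upper ss by simp
  show "w \<in> zero_set (tooth s) s" if w: "w \<in> D s" "L.level w = j" for w
  proof -
    have "has_join (tooth s)" "s \<in> verts (tooth s)" using pr by (auto simp: primal_def)
    then show ?thesis unfolding H.zero_set_iff[OF \<open>has_join (tooth s)\<close> \<open>s \<in> verts (tooth s)\<close>] T0 tau
      using upper lower w by (metis not_le tooth_sel(1))
  qed
qed

end

text \<open>\<open>nm\<close> provides the tooth vertices of the comb: the tooth rooted at \<open>s\<close> is contracted into \<open>nm s\<close>.\<close>

locale maximal_extreme_naming = maximal_extreme K X P Q x0 for K :: "('v, 'e) bgraft" and X P Q x0 +
  fixes nm :: "'v \<Rightarrow> 'v"
  assumes nm_inj: "inj_on nm (verts K)" and nm_new: "nm ` verts K \<inter> verts K = {}"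
begin

abbreviation "K' \<equiv> fringe_removal K X"
definition B :: "'v set" where "B = nm ` I"
definition root :: "'v \<Rightarrow> 'v" where "root = the_inv_into I nm"
abbreviation "V b \<equiv> D (root b)"
abbreviation "CG \<equiv> contract K' B V"
definition G :: "('v, 'e) bgraft" where
  "G = \<lparr>verts = verts CG, edges = edges CG, ends = ends CG, terms = terms CG, colA = X, colB = B\<rparr>"

lemma I_verts: "I \<subseteq> verts K"
  using I_N N_X by blast

lemma root_nm: "s \<in> I \<Longrightarrow> root (nm s) = s"
  unfolding root_def using the_inv_into_f_f inj_on_subset[OF nm_inj I_verts] by metis

lemma root: "b \<in> B \<Longrightarrow> root b \<in> I \<and> nm (root b) = b"
  using root_nm by (auto simp: B_def)

lemma B_new: "B \<inter> verts K = {}"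
  using nm_new I_verts by (auto simp: B_def)

lemma D_verts: "b \<in> B \<Longrightarrow> V b \<subseteq> N"
  using root I_N D_N by blast

lemma V_unique: "b \<in> B \<Longrightarrow> b' \<in> B \<Longrightarrow> w \<in> V b \<Longrightarrow> w \<in> V b' \<Longrightarrow> b = b'"
  using root I_unique by metis

lemma N_V: "w \<in> N \<Longrightarrow> \<exists>b\<in>B. w \<in> V b"
proof -
  assume w: "w \<in> N"
  obtain s where s: "s \<in> I" "s \<in> D w" using D_I[OF w] .
  then have "w \<in> D s" using D_eq[of s w] D_self[OF w] by simp
  then show ?thesis using s root_nm by (auto simp: B_def)
qed

lemma N_Union: "N = (\<Union>b\<in>B. V b)"
  using N_V D_verts by blast

lemma K'_sel: "verts K' = X \<union> N" "ends K' = ends K" "terms K' = T \<inter> (X \<union> N)"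
  "colA K' = colA K \<inter> (X \<union> N)" "colB K' = colB K \<inter> (X \<union> N)"
  "edges K' = {e \<in> edges K. ends K e \<subseteq> X \<union> N}"
proof -
  have XV: "X \<union> N \<subseteq> verts K" using extreme_X N_X(2) by (auto simp: extreme_def)
  have fr: "v \<in> fringe K X \<longleftrightarrow> v \<in> verts K \<and> v \<notin> X \<union> N" for v by (auto simp: fringe_def)
  have T: "T \<subseteq> verts K" using KK.graft by (simp add: is_graft_def)
  have C: "colA K \<subseteq> verts K" "colB K \<subseteq> verts K" using K by (auto simp: bipartite_graft_def)
  show "verts K' = X \<union> N" using fr XV by (auto simp: fringe_removal_def)
  show "ends K' = ends K" by (simp add: fringe_removal_def)
  show "terms K' = T \<inter> (X \<union> N)" using fr T XV by (auto simp: fringe_removal_def)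
  show "colA K' = colA K \<inter> (X \<union> N)" using fr C XV by (auto simp: fringe_removal_def)
  show "colB K' = colB K \<inter> (X \<union> N)" using fr C XV by (auto simp: fringe_removal_def)
  have "ends K e \<inter> fringe K X = {} \<longleftrightarrow> ends K e \<subseteq> X \<union> N" if "e \<in> edges K" for e
    using fr KK.ends_verts[OF that] by blast
  then show "edges K' = {e \<in> edges K. ends K e \<subseteq> X \<union> N}" by (auto simp: fringe_removal_def)
qed

lemma bipartite_K': "bipartite_graft K'"
proof -
  have XV: "X \<union> N \<subseteq> verts K" using extreme_X N_X(2) by (auto simp: extreme_def)
  have fin: "finite (X \<union> N)" using XV KK.graft finite_subset by (auto simp: is_graft_def fin_mgraph_def)
  have *: "colA K \<union> colB K = verts K" "colA K \<inter> colB K = {}" using K by (auto simp: bipartite_graft_def)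
  have "\<exists>a\<in>colA K \<inter> (X \<union> N). \<exists>b\<in>colB K \<inter> (X \<union> N). ends K e = {a, b}" if e: "e \<in> edges K" "ends K e \<subseteq> X \<union> N" for e
  proof -
    obtain a b where ab: "a \<in> colA K" "b \<in> colB K" "ends K e = {a, b}"
      using K e(1) unfolding bipartite_graft_def by blast
    then have "a \<in> X \<union> N" "b \<in> X \<union> N" using e(2) by auto
    then show ?thesis using ab by blast
  qed
  then show ?thesis unfolding bipartite_graft_def is_graft_def fin_mgraph_def K'_sel
    using fin * XV KK.finE KK.card2 by (auto 0 3)
qed

lemma edge_K':
  assumes e: "e \<in> edges K'"
  obtains b where "b \<in> B" "ends K e \<subseteq> V b"
  | b x z where "b \<in> B" "x \<in> X" "z \<in> V b" "L.level z = j" "ends K e = {x, z}"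
proof -
  have eK: "e \<in> edges K" "ends K e \<subseteq> X \<union> N" using e K'_sel by auto
  obtain p q where pq: "p \<in> P" "q \<in> Q" "ends K e = {p, q}" "q \<notin> X" using edge_con[OF eK(1)] by metis
  then have qN: "q \<in> N" using eK(2) by auto
  then obtain b where b: "b \<in> B" "q \<in> V b" using N_V by blast
  have r: "root b \<in> N" using root I_N b by blast
  have eq: "ends K e = {q, p}" using pq(3) by auto
  show ?thesis
  proof (cases "p \<in> V b")
    case True
    then show ?thesis using that(1)[of b] b pq by auto
  next
    case False
    from edge_D[OF eK(1) eq r b(2) False] show ?thesis using that(2)[of b p q] b pq by auto
  qed
qed

lemma inside_K': "b \<in> B \<Longrightarrow> edges_inside K' (V b) = edges (tooth (root b))"
  using D_verts[of b] unfolding edges_inside_def K'_sel by auto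

lemma contract_vertex_eq: "b \<in> B \<Longrightarrow> w \<in> V b \<Longrightarrow> contract_vertex B V w = b" "x \<in> X \<Longrightarrow> contract_vertex B V x = x"
proof -
  show "b \<in> B \<Longrightarrow> w \<in> V b \<Longrightarrow> contract_vertex B V w = b"
    unfolding contract_vertex_def using V_unique by auto
  assume x: "x \<in> X"
  then have "\<not> (\<exists>b\<in>B. x \<in> V b)" using D_verts N_X(1) by blast
  then show "contract_vertex B V x = x" by (simp add: contract_vertex_def)
qed

lemma edges_G: "edges G = {e \<in> edges K'. \<not> (\<exists>b\<in>B. ends K e \<subseteq> V b)}"
  unfolding G_def contract_def edges_inside_def K'_sel by auto

lemma edge_G:
  assumes e: "e \<in> edges G"
  obtains b x z where "b \<in> B" "x \<in> X" "z \<in> V b" "L.level z = j" "ends K e = {x, z}" "ends G e = {x, b}"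
proof -
  have e': "e \<in> edges K'" "\<not> (\<exists>b\<in>B. ends K e \<subseteq> V b)" using e edges_G by auto
  from e'(1) show ?thesis
  proof (cases rule: edge_K')
    case (2 b x z)
    have "ends G e = contract_vertex B V ` ends K e" by (simp add: G_def contract_def K'_sel)
    then have "ends G e = {x, b}" using 2 contract_vertex_eq by simp
    then show ?thesis using that 2 by blast
  qed (use e'(2) in blast)
qed

lemma G_sel: "verts G = X \<union> B" "colA G = X" "colB G = B"
  "terms G = (T \<inter> X) \<union> {b \<in> B. odd (card (V b \<inter> T))}"
proof -
  have XN: "X \<inter> N = {}" using N_X(1) by blast
  show "verts G = X \<union> B" unfolding G_def contract_def using XN N_Union K'_sel(1) by auto
  show "colA G = X" "colB G = B" by (auto simp: G_def)
  have "V b \<inter> (T \<inter> (X \<union> N)) = V b \<inter> T" if "b \<in> B" for b using D_verts[OF that] by blast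
  then have "{b \<in> B. odd (card (V b \<inter> (T \<inter> (X \<union> N))))} = {b \<in> B. odd (card (V b \<inter> T))}" by auto
  moreover have "T \<inter> (X \<union> N) - (\<Union>b\<in>B. V b) = T \<inter> X" using XN N_Union by blast
  ultimately show "terms G = (T \<inter> X) \<union> {b \<in> B. odd (card (V b \<inter> T))}"
    by (simp add: G_def contract_def K'_sel)
qed

lemma bipartite_G: "bipartite_graft G"
proof -
  have XV: "X \<subseteq> verts K" using extreme_X by (simp add: extreme_def)
  have fin: "finite X" "finite B" using XV KK.graft finite_subset finite_I by (auto simp: is_graft_def fin_mgraph_def B_def)
  have XB: "X \<inter> B = {}" using XV B_new by blast
  have "edges G \<subseteq> edges K" using edges_G K'_sel(6) by auto
  then have fE: "finite (edges G)" using KK.finE finite_subset by blast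
  have e: "\<exists>x\<in>X. \<exists>b\<in>B. ends G e = {x, b}" if "e \<in> edges G" for e
    using edge_G[OF that] by metis
  have "ends G e \<subseteq> X \<union> B \<and> card (ends G e) = 2" if eG: "e \<in> edges G" for e
  proof -
    obtain x b where "x \<in> X" "b \<in> B" "ends G e = {x, b}" using e[OF eG] by blast
    moreover from this have "x \<noteq> b" using XB by auto
    ultimately show ?thesis by auto
  qed
  then show ?thesis unfolding bipartite_graft_def is_graft_def fin_mgraph_def G_sel
    using fin fE XB e by auto
qed

lemma crossing_b:
  assumes "b \<in> B" shows "{e \<in> F \<inter> edges G. b \<in> ends G e} = KK.crossing F (V b)"
proof -
  have r: "root b \<in> I" "root b \<in> N" using root I_N assms by blast+
  have XB: "X \<inter> B = {}" using extreme_X B_new by (auto simp: extreme_def)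
  { fix e assume e: "e \<in> F" "e \<in> edges G" "b \<in> ends G e"
    obtain b' x z where *: "b' \<in> B" "x \<in> X" "z \<in> V b'" "ends K e = {x, z}" "ends G e = {x, b'}"
      using edge_G[OF e(2)] by metis
    then have "b' = b" using e XB assms by auto
    moreover have "x \<notin> V b" using D_verts assms N_X(1) * by blast
    ultimately have "ends K e \<inter> V b = {z}" using * by auto
    then have "e \<in> KK.crossing F (V b)" using e by (simp add: KK.crossing_def) }
  moreover
  { fix e assume e: "e \<in> KK.crossing F (V b)"
    obtain x z where *: "x \<in> X" "z \<in> V b" "ends K e = {z, x}" "e \<in> F" using crossing_edge[OF e F(3) r(2)] by metis
    have xV: "x \<notin> V b'" if "b' \<in> B" for b' using D_verts that N_X(1) * by blast
    have "z \<in> N" using D_verts assms * by blast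
    then have "e \<in> edges G" unfolding edges_G K'_sel using * xV F(3) by auto
    moreover have "ends G e = contract_vertex B V ` ends K e" by (simp add: G_def contract_def K'_sel)
    then have "ends G e = {b, x}" using * contract_vertex_eq assms by simp
    ultimately have "e \<in> F \<inter> edges G \<and> b \<in> ends G e" using * by auto }
  ultimately show ?thesis by blast
qed

lemma spine_degree:
  assumes "x \<in> X" shows "{e \<in> F \<inter> edges G. x \<in> ends G e} = {e \<in> F. x \<in> ends K e}"
proof -
  have XB: "X \<inter> B = {}" using extreme_X B_new by (auto simp: extreme_def)
  { fix e assume e: "e \<in> F" "e \<in> edges G" "x \<in> ends G e"
    obtain b' x' z where *: "b' \<in> B" "x' \<in> X" "z \<in> V b'" "ends K e = {x', z}" "ends G e = {x', b'}"
      using edge_G[OF e(2)] by metis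
    then have "x \<in> ends K e" using e XB assms by auto }
  moreover
  { fix e assume e: "e \<in> F" "x \<in> ends K e"
    have eK: "e \<in> edges K" using e F by auto
    obtain p q where pq: "ends K e = {p, q}" "q \<notin> X" using edge_con[OF eK] by metis
    then have q: "ends K e = {q, x}" using e assms by auto
    then have "q \<in> I" using e assms by (auto simp: I_def)
    then have qb: "nm q \<in> B" "q \<in> V (nm q)" using root_nm D_self I_N by (auto simp: B_def)
    then have "e \<in> KK.crossing F (V (nm q))"
    proof -
      have "x \<notin> V (nm q)" using D_verts qb N_X(1) assms by blast
      then have "ends K e \<inter> V (nm q) = {q}" using q qb by auto
      then show ?thesis using e by (simp add: KK.crossing_def)
    qed
    then have "e \<in> edges G" using crossing_b[OF qb(1)] by blast
    moreover have "ends G e = contract_vertex B V ` ends K e" by (simp add: G_def contract_def K'_sel)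
    then have "x \<in> ends G e" using q contract_vertex_eq(2)[OF assms] by simp
    ultimately have "e \<in> edges G \<and> x \<in> ends G e" by blast }
  ultimately show ?thesis by blast
qed

lemma comb_G: "comb G"
proof (rule comb_of_perfect_join[OF bipartite_G])
  have r: "root b \<in> N" if "b \<in> B" for b using root I_N that by blast
  show deg: "card {e \<in> F \<inter> edges G. b \<in> ends G e} = 1" if "b \<in> colB G" for b
    using crossing_b[of b] crossing_F[OF r[of b]] that G_sel by simp
  have XV: "X \<subseteq> verts K" using extreme_X by (simp add: extreme_def)
  show "is_join G (F \<inter> edges G)"
    unfolding is_join_def
  proof (intro conjI ballI)
    fix v assume "v \<in> verts G"
    then consider "v \<in> X" | "v \<in> B" using G_sel by auto
    then show "odd (card {e \<in> F \<inter> edges G. v \<in> ends G e}) \<longleftrightarrow> v \<in> terms G"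
    proof cases
      case 1
      have "v \<in> T \<longleftrightarrow> v \<in> boundary (ends K) F" using F by (simp add: KK.joins_def)
      then have "odd (card {e \<in> F. v \<in> ends K e}) \<longleftrightarrow> v \<in> T" by (simp add: boundary_def)
      moreover have "v \<notin> B" using 1 XV B_new by blast
      ultimately show ?thesis using spine_degree[OF 1] G_sel(4) 1 by simp
    next
      case 2
      have "odd (card (boundary (ends K) F \<inter> V v))" using KK.parity_crossing[OF F(3)] crossing_F[OF r[OF 2]] by simp
      then have "v \<in> terms G" using F(1) 2 G_sel(4) by (simp add: KK.joins_def Int_commute)
      then show ?thesis using deg[of v] 2 G_sel by simp
    qed
  qed simp
qed

abbreviation "H b \<equiv> tooth (root b)"

lemma tooth_grafts_G: "tooth_grafts G H root"
  unfolding tooth_grafts_def disjoint_family_on_def G_sel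
proof (intro conjI ballI impI)
  fix b assume b: "b \<in> B"
  then have r: "root b \<in> I" "root b \<in> N" using root I_N by blast+
  show "bipartite_graft (H b)" "primal (H b) (root b)" using tooth_bipartite tooth_primal_zero r by blast+
  show "root b \<in> colA (H b)" using I_Q r D_self by simp
  have "V b \<inter> X = {}" "V b \<inter> B = {}" using D_verts[OF b] N_X B_new by blast+
  then show "verts (H b) \<inter> (X \<union> B) = {}" by auto
  fix b' assume "b' \<in> B" "b \<noteq> b'"
  then show "verts (H b) \<inter> verts (H b') = {}" using V_unique b by auto
qed

lemma synthesis_K': "synthesis K' G H root"
  unfolding synthesis_def
proof (intro conjI ballI)
  show "bipartite_graft K'" by (rule bipartite_K')
  have XN: "X \<union> N \<subseteq> verts K" "X \<inter> N = {}" using extreme_X N_X by (auto simp: extreme_def)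
  have "P \<inter> (X \<union> N) = X \<union> (\<Union>b\<in>B. V b \<inter> P)" using XP N_Union by blast
  moreover have "Q \<inter> (X \<union> N) = (\<Union>b\<in>B. V b \<inter> Q)" using XP N_Union PQ_verts by blast
  moreover have "{colA K', colB K'} = {P \<inter> (X \<union> N), Q \<inter> (X \<union> N)}" using PQ K'_sel by auto
  ultimately show "{colA K', colB K'} = {colA G \<union> (\<Union>v\<in>colB G. colB (H v)), \<Union>v\<in>colB G. colA (H v)}"
    by (simp add: G_sel)
  show "colB G \<inter> verts K' = {}" using B_new XN by (auto simp: G_sel K'_sel)
  show "same_graft (contract K' (colB G) (\<lambda>v. verts (H v))) G"
    by (simp add: same_graft_def G_def)
  fix b assume b: "b \<in> colB G"
  then have bB: "b \<in> B" by (simp add: G_sel)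
  then have r: "root b \<in> I" "root b \<in> N" "root b \<in> V b" using root I_N D_self by blast+
  show "subgraph (H b) K'"
    using D_verts[OF bB] by (auto simp: subgraph_def K'_sel)
  show "edges_inside K' (verts (H b)) = edges (H b)" using inside_K'[OF bB] by simp
  show "terms K' \<inter> verts (H b) = sym_diff (terms (H b)) {root b}"
    using D_verts[OF bB] r(3) by (auto simp: K'_sel)
  show "cut K' (verts (H b)) = edges_between K' (colA G) (zero_set (H b) (root b))"
  proof
    show "cut K' (verts (H b)) \<subseteq> edges_between K' (colA G) (zero_set (H b) (root b))"
    proof
      fix e assume e: "e \<in> cut K' (verts (H b))"
      then have "e \<in> KK.crossing (edges K') (V b)" by (simp add: cut_def KK.crossing_def K'_sel)
      moreover have "edges K' \<subseteq> edges K" by (auto simp: K'_sel)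
      ultimately obtain x z where "x \<in> X" "z \<in> V b" "ends K e = {z, x}" "L.level z = j" "e \<in> edges K'"
        using crossing_edge[OF _ _ r(2)] by metis
      then show "e \<in> edges_between K' (colA G) (zero_set (H b) (root b))"
        using tooth_primal_zero(2)[OF r(1)] by (auto simp: edges_between_def G_sel K'_sel(2))
    qed
    show "edges_between K' (colA G) (zero_set (H b) (root b)) \<subseteq> cut K' (verts (H b))"
    proof
      fix e assume "e \<in> edges_between K' (colA G) (zero_set (H b) (root b))"
      then obtain x z where *: "e \<in> edges K'" "x \<in> X" "z \<in> V b" "ends K' e = {x, z}"
        by (auto simp: edges_between_def G_sel zero_set_def)
      then have "x \<notin> V b" using D_verts[OF bB] N_X(1) by blast
      then have "ends K' e \<inter> V b = {z}" using * by auto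
      then show "e \<in> cut K' (verts (H b))" using * by (simp add: cut_def)
    qed
  qed
qed

end

lemma decomposition_exists:
  fixes K :: "('v, 'e) bgraft"
  assumes K: "bipartite_graft K" and max: "maximal_bipartitic_extreme K X" and inf: "infinite (UNIV :: 'v set)"
  shows "\<exists>G H r. comb G \<and> colA G = X \<and> tooth_grafts G H r \<and> synthesis (fringe_removal K X) G H r"
proof (cases "X = {}")
  case False
  then obtain x0 where x0: "x0 \<in> X" by auto
  have "finite (verts K)" using K by (auto simp: bipartite_graft_def is_graft_def fin_mgraph_def)
  then have "infinite (UNIV - verts K)" using inf by simp
  then obtain W where W: "W \<subseteq> UNIV - verts K" "finite W" "card W = card (verts K)"
    using infinite_arbitrarily_large by metis
  then obtain nm where nm: "bij_betw nm (verts K) W"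
    using finite_same_card_bij[OF \<open>finite (verts K)\<close> W(2)] by auto
  obtain P Q where PQ: "P = colA K \<and> Q = colB K \<or> P = colB K \<and> Q = colA K" "X \<subseteq> P"
    using max unfolding maximal_bipartitic_extreme_def bipartitic_def by blast
  interpret maximal_extreme_naming K X P Q x0 nm
    by unfold_locales (use K PQ max x0 nm W in \<open>auto simp: bij_betw_def\<close>)
  show ?thesis using comb_G G_sel(2) tooth_grafts_G synthesis_K' by blast
next
  case True
  interpret KK: graft_join K using bipartite_graft_join[OF K] .
  have extreme_X: "extreme K {}" and no: "\<And>Y. {} \<subset> Y \<Longrightarrow> bipartitic K Y \<Longrightarrow> \<not> extreme K Y"
    using max True unfolding maximal_bipartitic_extreme_def by blast+
  have verts: "verts K = {}"
  proof (rule ccontr)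
    assume "verts K \<noteq> {}"
    then obtain v where v: "v \<in> verts K" by auto
    then have "bipartitic K {v}" using K by (auto simp: bipartite_graft_def bipartitic_def)
    moreover have "extreme K {v}"
      using extreme_X v KK.tau_le unfolding KK.extreme_iff by (auto simp: sdiff_ac)
    ultimately show False using no by blast
  qed
  have edges: "edges K = {}" using KK.ends_verts KK.card2 verts by fastforce
  define G where "G = (fringe_removal K {})\<lparr>colA := {}, colB := {}\<rparr>"
  have T: "terms K = {}" "colA K = {}" "colB K = {}"
    using KK.graft verts K by (auto simp: is_graft_def bipartite_graft_def)
  have G: "verts G = {}" "edges G = {}" "terms G = {}" "colA G = {}" "colB G = {}"
    using verts edges T by (auto simp: G_def fringe_removal_def)
  have K': "verts (fringe_removal K {}) = {}" "edges (fringe_removal K {}) = {}" "terms (fringe_removal K {}) = {}"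
    "colA (fringe_removal K {}) = {}" "colB (fringe_removal K {}) = {}"
    using verts edges T by (auto simp: fringe_removal_def)
  have "is_join G {}" by (simp add: is_join_def G)
  then have "comb G" unfolding comb_def has_join_def
    by (auto simp: bipartite_graft_def is_graft_def fin_mgraph_def G)
  moreover have "tooth_grafts G (\<lambda>_. G) (\<lambda>v. v)" by (simp add: tooth_grafts_def G disjoint_family_on_def)
  moreover have "synthesis (fringe_removal K {}) G (\<lambda>_. G) (\<lambda>v. v)"
    unfolding synthesis_def by (simp add: G K' bipartite_graft_def is_graft_def fin_mgraph_def same_graft_def contract_def)
  ultimately show ?thesis using True G(4) by blast
qed

theorem theorem7p9:
  fixes K :: "('v, 'e) bgraft"
  assumes "bipartite_graft K"
  shows "(\<forall>G H r. comb G \<and> tooth_grafts G H r \<and> synthesis K G H r \<longrightarrow>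
            maximal_bipartitic_extreme K (colA G) \<and> fringe K (colA G) = {}) \<and>
         (infinite (UNIV :: 'v set) \<longrightarrow>
           (\<forall>A. maximal_bipartitic_extreme K A \<longrightarrow>
             (\<exists>G H r. comb G \<and> colA G = A \<and> tooth_grafts G H r \<and>
                synthesis (fringe_removal K A) G H r)))"
proof (intro conjI allI impI)
  fix G H r assume "comb G \<and> tooth_grafts G H r \<and> synthesis K G H r"
  then interpret synthesis_setting K G H r by unfold_locales (use assms in auto)
  show "maximal_bipartitic_extreme K (colA G)" "fringe K (colA G) = {}"
    using maximal_A fringe_empty by blast+
next
  fix A assume "infinite (UNIV :: 'v set)" "maximal_bipartitic_extreme K A"
  then show "\<exists>G H r. comb G \<and> colA G = A \<and> tooth_grafts G H r \<and> synthesis (fringe_removal K A) G H r"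
    using decomposition_exists assms by blast
qed

end
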